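(* Let $G=(V,E)$ be a simple, connected, non-bipartite graph with edge ideal $I_G$, and let $U\subset V$. Then $\mathfrak m^{\mathbf 1_U}$ is an embedded associated prime of $I_G^k$ for some $k$ if and only if $Z:=V\setminus U$ is a coclique set (possibly empty), $U\ne N(Z)$, and every connected component of $G_{U\setminus N(Z)}$ contains an odd cycle.
   Context: Graphs are finite. Write $V=\{P_1,\dots,P_d\}$ and $R=K[x_1,\dots,x_d]$ with $K$ a field. The edge ideal of $G$ is $I_G=(x_ix_j : P_iP_j\in E)\subset R$. For $U\subset V$, $\mathfrak m^{\mathbf 1_U}$ is the prime ideal generated by the variables $x_i$ with $P_i\in U$, and $G_U$ is the subgraph of $G$ induced on $U$. An associated prime of $R/I_G^k$ is embedded if it is not a minimal prime of $I_G^k$. A coclique set is an independent set of vertices. For $S\subset V$, $N(S)$ is the set of vertices of $G$ adjacent to at least one vertex of $S$ (so $N(\emptyset)=\emptyset$). *)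

theory Defs
  imports "HOL-Library.Poly_Mapping" "HOL-Algebra.Ideal_Product" "HOL-Algebra.QuotRing"
    "HOL-Algebra.Algebraic_Closure_Type"
begin

section \<open>Graphs\<close>

text \<open>A graph is given by a vertex set \<open>V\<close> and a set \<open>E\<close> of edges, each edge being the set of
  its two end points.\<close>

definition simple_graph :: "'v set \<Rightarrow> 'v set set \<Rightarrow> bool" where
  "simple_graph V E \<longleftrightarrow> finite V \<and> (\<forall>e\<in>E. e \<subseteq> V \<and> card e = 2)"

abbreviation adjacent :: "'v set set \<Rightarrow> 'v \<Rightarrow> 'v \<Rightarrow> bool" where
  "adjacent E \<equiv> \<lambda>u v. {u, v} \<in> E"

definition connected_graph :: "'v set \<Rightarrow> 'v set set \<Rightarrow> bool" where
  "connected_graph V E \<longleftrightarrow> V \<noteq> {} \<and> (\<forall>u\<in>V. \<forall>v\<in>V. (adjacent E)\<^sup>*\<^sup>* u v)"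

definition bipartite_graph :: "'v set \<Rightarrow> 'v set set \<Rightarrow> bool" where
  "bipartite_graph V E \<longleftrightarrow>
    (\<exists>A B. A \<inter> B = {} \<and> A \<union> B = V \<and> (\<forall>e\<in>E. \<exists>a\<in>A. \<exists>b\<in>B. e = {a, b}))"

definition induced_edges :: "'v set set \<Rightarrow> 'v set \<Rightarrow> 'v set set" where
  "induced_edges E W = {e \<in> E. e \<subseteq> W}"

definition graph_components :: "'v set \<Rightarrow> 'v set set \<Rightarrow> 'v set set" where
  "graph_components V E = {{v \<in> V. (adjacent E)\<^sup>*\<^sup>* u v} | u. u \<in> V}"

definition graph_cycle :: "'v set set \<Rightarrow> 'v list \<Rightarrow> bool" where
  "graph_cycle E vs \<longleftrightarrow> 3 \<le> length vs \<and> distinct vs \<and>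
    (\<forall>i<length vs. adjacent E (vs ! i) (vs ! (Suc i mod length vs)))"

definition contains_odd_cycle :: "'v set \<Rightarrow> 'v set set \<Rightarrow> bool" where
  "contains_odd_cycle C E \<longleftrightarrow> (\<exists>vs. graph_cycle E vs \<and> set vs \<subseteq> C \<and> odd (length vs))"

definition coclique :: "'v set set \<Rightarrow> 'v set \<Rightarrow> bool" where
  "coclique E S \<longleftrightarrow> (\<forall>u\<in>S. \<forall>v\<in>S. \<not> adjacent E u v)"

definition neighbours :: "'v set set \<Rightarrow> 'v set \<Rightarrow> 'v set" where
  "neighbours E S = {v. \<exists>s\<in>S. adjacent E s v}"


section \<open>Associated and embedded primes\<close>

abbreviation ideal_power :: "('a, 'b) ring_scheme \<Rightarrow> 'a set \<Rightarrow> nat \<Rightarrow> 'a set" where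
  "ideal_power R I k \<equiv> I [^]\<^bsub>ideals_set R\<^esub> k"

text \<open>\<open>P\<close> is an associated prime of the \<open>R\<close>-module \<open>R/J\<close>: it is the annihilator of some element.
  The scalar \<open>r\<close> acts on \<open>R/J\<close> as multiplication by its residue class.\<close>

definition associated_prime :: "('a, 'b) ring_scheme \<Rightarrow> 'a set \<Rightarrow> 'a set \<Rightarrow> bool" where
  "associated_prime R J P \<longleftrightarrow> primeideal P R \<and>
    (\<exists>m\<in>carrier (R Quot J).
      P = {r \<in> carrier R. (J +>\<^bsub>R\<^esub> r) \<otimes>\<^bsub>R Quot J\<^esub> m = \<zero>\<^bsub>R Quot J\<^esub>})"

definition minimal_prime :: "('a, 'b) ring_scheme \<Rightarrow> 'a set \<Rightarrow> 'a set \<Rightarrow> bool" where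
  "minimal_prime R J P \<longleftrightarrow> primeideal P R \<and> J \<subseteq> P \<and>
    (\<forall>Q. primeideal Q R \<and> J \<subseteq> Q \<and> Q \<subseteq> P \<longrightarrow> Q = P)"

definition embedded_prime :: "('a, 'b) ring_scheme \<Rightarrow> 'a set \<Rightarrow> 'a set \<Rightarrow> bool" where
  "embedded_prime R J P \<longleftrightarrow> associated_prime R J P \<and> \<not> minimal_prime R J P"


section \<open>Edge ideals\<close>

text \<open>Polynomials over \<open>'k\<close> with one indeterminate for each element of \<open>'v\<close>: finitely supported
  coefficient functions on the exponent vectors.\<close>

type_synonym ('v, 'k) mpoly = "('v \<Rightarrow>\<^sub>0 nat) \<Rightarrow>\<^sub>0 'k"

abbreviation mpoly_ring :: "('v, 'k::field) mpoly ring" where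
  "mpoly_ring \<equiv> ring_of_type_algebra"

definition Var :: "'v \<Rightarrow> ('v, 'k::field) mpoly" where
  "Var i = Poly_Mapping.single (Poly_Mapping.single i 1) 1"

definition edge_ideal :: "'v set set \<Rightarrow> ('v, 'k::field) mpoly set" where
  "edge_ideal E = Idl\<^bsub>mpoly_ring\<^esub> {Var i * Var j | i j. {i, j} \<in> E}"

definition variable_ideal :: "'v set \<Rightarrow> ('v, 'k::field) mpoly set" where
  "variable_ideal U = Idl\<^bsub>mpoly_ring\<^esub> (Var ` U)"

end

theory Submission
  imports Defs
begin

text \<open>
  The power \<open>I\<^sup>k\<close> is the monomial ideal of those monomials that are divisible by a product of \<open>k\<close>
  edges. Multiplying a witness of an associated prime \<open>m\<^sub>U\<close> by a high power of the variables in \<open>Z\<close>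
  yields a monomial \<open>w\<close> such that \<open>w \<cdot> z\<^sup>n\<close> does not contain \<open>k\<close> edges but \<open>w \<cdot> x\<^sub>u\<close> does for every \<open>u \<in> U\<close>.
  Since the vertices in \<open>N(Z)\<close> can all be matched into the large power of the variables in \<open>Z\<close>, every
  component \<open>C\<close> of the graph on \<open>U - N(Z)\<close> inherits the property that enlarging \<open>w\<close> at any vertex of \<open>C\<close>
  enlarges the maximal number of edges; for bipartite \<open>C\<close> this contradicts Koenig's theorem applied to
  the exponents as vertex multiplicities.

  Conversely, a closed walk of odd length that visits every vertex of \<open>C\<close> has this property: with any
  one of its vertices doubled, it can be cut into disjoint edges. The product of such
  walks over all components, times the variables in \<open>Z\<close>, is a witness.
\<close>

section \<open>Matchings in vertex multisets\<close>

text \<open>Edges may be repeated and the base case leaves an arbitrary rest, so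
  \<open>matched E k a\<close> means that \<open>a\<close> contains the sum of \<open>k\<close>
  edges: the monomial with exponents \<open>a\<close> is divisible by a product of \<open>k\<close>
  edges.\<close>

inductive matched :: "'v set set \<Rightarrow> nat \<Rightarrow> 'v multiset \<Rightarrow> bool" for E where
  matched_0: "matched E 0 a"
| matched_Suc: "{u, v} \<in> E \<Longrightarrow> matched E k a \<Longrightarrow> matched E (Suc k) ({#u, v#} + a)"

lemma matched_add_mset: "{u, v} \<in> E \<Longrightarrow> matched E k a \<Longrightarrow> matched E (Suc k) (add_mset u (add_mset v a))"
  using matched_Suc[of u v E k a] by simp

lemma matched_add:
  assumes "matched E j a" "matched E k b"
  shows "matched E (j + k) (a + b)"
  using assms
proof (induction rule: matched.induct)
  case (matched_0 a)
  then have "matched E k (b + a)"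
    by (induction rule: matched.induct) (auto intro: matched.matched_0 matched_add_mset)
  thus ?case by (simp add: add.commute)
next
  case (matched_Suc u v j a)
  then show ?case by (auto intro: matched_add_mset)
qed

lemma matched_mono: "matched E k a \<Longrightarrow> a \<subseteq># b \<Longrightarrow> matched E k b"
  using matched_add[OF _ matched_0, of E k a "b - a"] by simp

lemma matched_SucD: "matched E (Suc k) a \<Longrightarrow> matched E k a"
  by (auto elim!: matched.cases[of E "Suc k" a] intro: matched_mono)

lemma matched_le: "matched E k a \<Longrightarrow> j \<le> k \<Longrightarrow> matched E j a"
  by (induction k arbitrary: j) (auto simp: le_Suc_eq dest: matched_SucD)

lemma matched_edges_mono: "matched E k a \<Longrightarrow> E \<subseteq> F \<Longrightarrow> matched F k a"
  by (induction rule: matched.induct) (auto intro: matched.matched_0 matched_add_mset)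

lemma matched_sum:
  assumes "finite F" "\<And>x. x \<in> F \<Longrightarrow> matched E (m x) (a x)"
  shows "matched E (\<Sum>x\<in>F. m x) (\<Sum>x\<in>F. a x)"
  using assms by (induction F rule: finite_induct) (auto intro: matched_add matched_0)

text \<open>Weak duality: \<open>S\<close> is a vertex cover, and each of the \<open>k\<close> edges
  uses up an element of \<open>a\<close> that lies in \<open>S\<close>.\<close>

lemma matched_le_cover:
  assumes "matched E k a" "\<And>e. e \<in> E \<Longrightarrow> e \<inter> S \<noteq> {}"
  shows "k \<le> size {#x \<in># a. x \<in> S#}"
  using assms by (induction rule: matched.induct) fastforce+

text \<open>Each edge is charged to one of three groups: an edge meeting \<open>N\<close> costs an
  element of \<open>N\<close>, the others stay edges of the graph on \<open>C\<close> or on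
  \<open>D\<close>. This isolates what one component contributes.\<close>

lemma matched_split:
  assumes "matched E k a" "\<And>e. e \<in> E \<Longrightarrow> e \<inter> N \<noteq> {} \<or> e \<subseteq> C \<or> e \<subseteq> D"
  shows "\<exists>i j l. k = i + j + l \<and> i \<le> size {#x \<in># a. x \<in> N#} \<and>
    matched (induced_edges E C) j {#x \<in># a. x \<in> C#} \<and> matched (induced_edges E D) l {#x \<in># a. x \<in> D#}"
  using assms
proof (induction rule: matched.induct)
  case (matched_0 a)
  then show ?case by (auto intro: matched.intros)
next
  case (matched_Suc u v k a)
  then obtain i j l where *: "k = i + j + l" "i \<le> size {#x \<in># a. x \<in> N#}"
    "matched (induced_edges E C) j {#x \<in># a. x \<in> C#}" "matched (induced_edges E D) l {#x \<in># a. x \<in> D#}"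
    by blast
  have up: "{#x \<in># a. x \<in> Y#} \<subseteq># {#x \<in># {#u, v#} + a. x \<in> Y#}" for Y by (simp add: multiset_filter_mono)
  have le: "size {#x \<in># a. x \<in> N#} \<le> size {#x \<in># {#u, v#} + a. x \<in> N#}"
    by (rule size_mset_mono[OF up])
  have step: "matched (induced_edges E Y) (Suc n) {#x \<in># {#u, v#} + a. x \<in> Y#}"
    if "{u, v} \<subseteq> Y" "matched (induced_edges E Y) n {#x \<in># a. x \<in> Y#}" for Y n
  proof -
    have "{u, v} \<in> induced_edges E Y" using that matched_Suc.hyps by (simp add: induced_edges_def)
    from matched.matched_Suc[OF this that(2)] show ?thesis using that(1) by simp
  qed
  consider "{u, v} \<inter> N \<noteq> {}" | "{u, v} \<subseteq> C" | "{u, v} \<subseteq> D" using matched_Suc by blast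
  then show ?case
  proof cases
    case 1
    then have "Suc i \<le> size {#x \<in># {#u, v#} + a. x \<in> N#}" using *(2) by auto
    moreover have "Suc k = Suc i + j + l" using *(1) by simp
    ultimately show ?thesis using matched_mono[OF *(3) up] matched_mono[OF *(4) up] by blast
  next
    case 2
    moreover have "Suc k = i + Suc j + l" using *(1) by simp
    ultimately show ?thesis using step[OF 2 *(3)] matched_mono[OF *(4) up] le *(2) le_trans by blast
  next
    case 3
    moreover have "Suc k = i + j + Suc l" using *(1) by simp
    ultimately show ?thesis using step[OF 3 *(4)] matched_mono[OF *(3) up] le *(2) le_trans by blast
  qed
qed

section \<open>Koenig's theorem with vertex multiplicities\<close>

lemma size_filter_Un_le:
  "size {#x \<in># a. x \<in> S \<union> T#} \<le> size {#x \<in># a. x \<in> S#} + size {#x \<in># a. x \<in> T#}"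
  by (induction a) auto

text \<open>Either removing some edge from \<open>w\<close> lowers the minimal cover weight by at most one, or a minimal
  cover contains both ends of that edge and splits \<open>w\<close> into two strictly smaller multisets.\<close>

lemma koenig_weighted:
  fixes w :: "'a multiset" and E :: "'a set set"
  assumes bip: "\<And>e. e \<in> E \<Longrightarrow> \<exists>a\<in>A. \<exists>b. b \<notin> A \<and> e = {a, b}"
  shows "\<exists>S. (\<forall>e\<in>E. e \<inter> S \<noteq> {}) \<and> matched E (size {#x \<in># w. x \<in> S#}) w"
proof (induction "size w" arbitrary: w rule: less_induct)
  case less
  define wt where "wt a S = size {#x \<in># a. x \<in> S#}" for a :: "'a multiset" and S
  define cover where "cover S \<longleftrightarrow> (\<forall>e\<in>E. e \<inter> S \<noteq> {})" for S
  have IH: "\<exists>S. cover S \<and> matched E (wt a S) a" if "size a < size w" for a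
    using less that unfolding wt_def cover_def by blast
  have "\<exists>S. cover S \<and> matched E (wt w S) w"
  proof (cases "\<exists>e\<in>E. e \<subseteq> set_mset w")
    case False
    \<comment> \<open>Without an edge inside the support of \<open>w\<close>, the complement of the
      support is a cover of weight zero.\<close>
    have "cover (- set_mset w)" unfolding cover_def using False by blast
    moreover have "wt w (- set_mset w) = 0" by (auto simp: wt_def multiset_eq_iff not_in_iff)
    ultimately show ?thesis using matched_0 by metis
  next
    case True
    then obtain u v where uv: "{u, v} \<in> E" "u \<in> A" "v \<notin> A" "u \<in># w" "v \<in># w"
      using bip by (metis insert_subset)
    then obtain w' where w': "w = {#u, v#} + w'"
      by (metis insert_DiffM insert_noteq_member add_mset_add_single union_mset_add_mset_left add_0)
    have "\<exists>S. cover S" unfolding cover_def by (rule exI[of _ UNIV]) (use bip in blast)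
    then obtain T where T: "cover T" "\<And>S. cover S \<Longrightarrow> wt w T \<le> wt w S"
      using ex_has_least_nat[of cover _ "wt w"] by blast
    obtain S where S: "cover S" "matched E (wt w' S) w'" using IH[of w'] w' by auto
    have m: "matched E (Suc (wt w' S)) w" unfolding w' using matched_Suc[OF uv(1) S(2)] .
    show ?thesis
    proof (cases "wt w T \<le> Suc (wt w' S)")
      case True
      then show ?thesis using T(1) matched_le[OF m] by blast
    next
      case False
      \<comment> \<open>The minimal cover weight of \<open>w\<close> now exceeds the weight of
        \<open>S\<close> on \<open>w'\<close> by at least two. Only \<open>u\<close> and
        \<open>v\<close> are added, so \<open>S\<close> contains both and is minimal for
        \<open>w\<close>.\<close>
      have eq: "wt w S = wt w' S + (if u \<in> S then 1 else 0) + (if v \<in> S then 1 else 0)"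
        by (simp add: wt_def w')
      with T(2)[OF S(1)] False have "u \<in> S" "v \<in> S" and min: "wt w T = wt w S"
        by (auto split: if_splits)
      \<comment> \<open>\<open>K\<close> consists of the part of \<open>A\<close> inside
        \<open>S\<close> and the part of the complement of \<open>A\<close> outside
        \<open>S\<close>. An edge not inside \<open>S\<close> lies wholly in \<open>K\<close> or
        wholly outside it, while \<open>K\<close> separates \<open>u\<close> from \<open>v\<close>,
        so both pieces of \<open>w\<close> are smaller.\<close>
      define K where "K = {x. x \<in> A \<longleftrightarrow> x \<in> S}"
      define w1 w2 where "w1 = {#x \<in># w. x \<in> K#}" and "w2 = {#x \<in># w. x \<notin> K#}"
      have w12: "w = w1 + w2" by (simp add: w1_def w2_def)
      have "v \<notin># w1" "u \<notin># w2" using uv \<open>u \<in> S\<close> \<open>v \<in> S\<close> by (auto simp: w1_def w2_def K_def)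
      then have "size w1 < size w" "size w2 < size w"
        using uv(4,5) w12 by (auto simp flip: nonempty_has_size)
      then obtain S1 S2 where S1: "cover S1" "matched E (wt w1 S1) w1"
        and S2: "cover S2" "matched E (wt w2 S2) w2" using IH by metis
      \<comment> \<open>An edge whose end outside \<open>A\<close> is not in \<open>S\<close> lies
        in \<open>K\<close>, so \<open>S1\<close> meets it inside \<open>K\<close>. The cover built
        from \<open>S2\<close> is the mirror image.\<close>
      have "cover ((S1 \<inter> K) \<union> (S - A))"
        unfolding cover_def
      proof
        fix e assume e: "e \<in> E"
        obtain a b where "a \<in> A" "b \<notin> A" "e = {a, b}" using bip[OF e] by blast
        moreover have "e \<inter> S \<noteq> {}" "e \<inter> S1 \<noteq> {}" using e S(1) S1(1) by (auto simp: cover_def)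
        ultimately show "e \<inter> ((S1 \<inter> K) \<union> (S - A)) \<noteq> {}" by (auto simp: K_def)
      qed
      then have "wt w S \<le> wt w ((S1 \<inter> K) \<union> (S - A))" using T(2) min by simp
      also have "\<dots> \<le> wt w (S1 \<inter> K) + wt w (S - A)" unfolding wt_def by (rule size_filter_Un_le)
      also have "wt w (S1 \<inter> K) = wt w1 S1" by (simp add: wt_def w1_def filter_filter_mset conj_commute)
      finally have 1: "wt w S \<le> wt w1 S1 + wt w (S - A)" .
      have "cover ((S2 - K) \<union> (S \<inter> A))"
        unfolding cover_def
      proof
        fix e assume e: "e \<in> E"
        obtain a b where "a \<in> A" "b \<notin> A" "e = {a, b}" using bip[OF e] by blast
        moreover have "e \<inter> S \<noteq> {}" "e \<inter> S2 \<noteq> {}" using e S(1) S2(1) by (auto simp: cover_def)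
        ultimately show "e \<inter> ((S2 - K) \<union> (S \<inter> A)) \<noteq> {}" by (auto simp: K_def)
      qed
      then have "wt w S \<le> wt w ((S2 - K) \<union> (S \<inter> A))" using T(2) min by simp
      also have "\<dots> \<le> wt w (S2 - K) + wt w (S \<inter> A)" unfolding wt_def by (rule size_filter_Un_le)
      also have "wt w (S2 - K) = wt w2 S2" by (simp add: wt_def w2_def filter_filter_mset conj_commute)
      finally have 2: "wt w S \<le> wt w2 S2 + wt w (S \<inter> A)" .
      \<comment> \<open>Adding the bounds \<open>1\<close> and \<open>2\<close> gives the weight of
        \<open>S\<close> twice on the left and once on the right, split along
        \<open>A\<close>.\<close>
      have "wt w S = wt w (S \<inter> A) + wt w (S - A)"
        unfolding wt_def by (induction w) auto
      with 1 2 have "wt w S \<le> wt w1 S1 + wt w2 S2" by linarith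
      then show ?thesis using S(1) matched_le[OF matched_add[OF S1(2) S2(2)]] w12 by metis
    qed
  qed
  then show ?case by (simp add: wt_def cover_def)
qed

section \<open>Odd cycles and bipartitions\<close>

lemma successively_iff_nth:
  "successively P xs \<longleftrightarrow> (\<forall>i. Suc i < length xs \<longrightarrow> P (xs ! i) (xs ! Suc i))"
proof (induction xs rule: induct_list012)
  case (3 x y zs)
  then show ?case by (auto simp: nth_Cons split: nat.split)
qed auto

text \<open>Closing the list by its head replaces the index modulo the length, so that cycles can be
  cut and rotated as lists.\<close>

lemma graph_cycle_iff:
  "graph_cycle E vs \<longleftrightarrow> 3 \<le> length vs \<and> distinct vs \<and> successively (adjacent E) (vs @ [hd vs])"
proof (cases "vs = []")
  case False
  have "vs ! (Suc i mod length vs) = (vs @ [hd vs]) ! Suc i" if "i < length vs" for i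
  proof (cases "Suc i = length vs")
    case True
    then show ?thesis using False by (simp add: nth_append hd_conv_nth)
  next
    case False
    then show ?thesis using that by (simp add: nth_append)
  qed
  then show ?thesis by (auto simp: graph_cycle_def successively_iff_nth nth_append)
qed (auto simp: graph_cycle_def)

text \<open>A repeated vertex splits the walk into two shorter closed walks whose lengths add up, so
  one of them is odd. A walk without repetition is a cycle, since length one would be a
  loop.\<close>

lemma odd_closed_walk_contains_odd_cycle:
  assumes noloop: "\<And>v. {v} \<notin> E"
    and "odd (length vs)" "set vs \<subseteq> C" "successively (adjacent E) (vs @ [hd vs])"
  shows "contains_odd_cycle C E"
  using assms(2-)
proof (induction "length vs" arbitrary: vs rule: less_induct)
  case less
  show ?case
  proof (cases "distinct vs")
    case True
    have "length vs \<noteq> 1" using less.prems(3) noloop by (cases vs) auto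
    then have "3 \<le> length vs" using less.prems(1) by presburger
    then show ?thesis using less True unfolding contains_odd_cycle_def graph_cycle_iff by blast
  next
    case False
    then obtain as u bs cs where vs: "vs = as @ [u] @ bs @ [u] @ cs" using not_distinct_decomp by blast
    have inner: "successively (adjacent E) ((u # bs) @ [hd (u # bs)])"
      using less.prems(3) by (auto simp: vs successively_append_iff successively_Cons hd_append split: if_splits)
    have outer: "successively (adjacent E) ((as @ u # cs) @ [hd (as @ u # cs)])"
      using less.prems(3) by (auto simp: vs successively_append_iff successively_Cons hd_append split: if_splits)
    have "odd (length (u # bs)) \<or> odd (length (as @ u # cs))" using less.prems(1) by (auto simp: vs)
    then show ?thesis
      using less.hyps[OF _ _ _ inner] less.hyps[OF _ _ _ outer] less.prems(2) by (auto simp: vs)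
  qed
qed

text \<open>The end point is left out of the list, so a closed walk of length \<open>n > 0\<close>
  becomes a list of \<open>n\<close> vertices in the form that \<open>graph_cycle_iff\<close>
  uses.\<close>

lemma relpowp_walk:
  "(R ^^ n) x y \<Longrightarrow>
    \<exists>xs. length xs = n \<and> successively R (xs @ [y]) \<and> hd (xs @ [y]) = x \<and> set xs \<subseteq> {v. R\<^sup>*\<^sup>* x v}"
proof (induction n arbitrary: x)
  case 0
  then show ?case by simp
next
  case (Suc n)
  then obtain z where z: "R x z" "(R ^^ n) z y" by (meson relpowp_Suc_D2)
  from Suc.IH[OF z(2)] obtain xs where
    "length xs = n" "successively R (xs @ [y])" "hd (xs @ [y]) = z" "set xs \<subseteq> {v. R\<^sup>*\<^sup>* z v}" by blast
  with z(1) have "length (x # xs) = Suc n" "successively R ((x # xs) @ [y])" "hd ((x # xs) @ [y]) = x"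
    "set (x # xs) \<subseteq> {v. R\<^sup>*\<^sup>* x v}"
    by (auto simp: successively_Cons intro: converse_rtranclp_into_rtranclp)
  then show ?case by blast
qed

lemma relpowp_adjacent_sym: "((adjacent E) ^^ n) u v \<Longrightarrow> ((adjacent E) ^^ n) v u"
proof (induction n arbitrary: v)
  case (Suc n)
  then obtain w where w: "((adjacent E) ^^ n) u w" "{w, v} \<in> E" by auto
  show ?case by (rule relpowp_Suc_I2[OF _ Suc.IH[OF w(1)]]) (use w(2) in \<open>simp add: insert_commute\<close>)
qed auto

lemma reachable_sym: "(adjacent E)\<^sup>*\<^sup>* u v \<Longrightarrow> (adjacent E)\<^sup>*\<^sup>* v u"
  by (auto dest!: rtranclp_imp_relpowp intro: relpowp_imp_rtranclp relpowp_adjacent_sym)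

text \<open>Vertices are coloured by the parity of walks from \<open>r\<close>. Two walks of
  different parity to one vertex would close up to an odd closed walk in the component, which
  contains an odd cycle.\<close>

lemma no_odd_cycle_bipartition:
  assumes card2: "\<And>e. e \<in> E \<Longrightarrow> card e = 2"
    and no: "\<not> contains_odd_cycle {v. (adjacent E)\<^sup>*\<^sup>* r v} E"
    and e: "e \<in> induced_edges E {v. (adjacent E)\<^sup>*\<^sup>* r v}"
    and A: "A = {v. \<exists>n. even n \<and> ((adjacent E) ^^ n) r v}"
  shows "\<exists>a\<in>A. \<exists>b. b \<notin> A \<and> e = {a, b}"
proof -
  have even: "even n" if walk: "((adjacent E) ^^ n) r r" for n
  proof (rule ccontr)
    assume "odd n"
    obtain xs where xs: "length xs = n" "successively (adjacent E) (xs @ [r])" "hd (xs @ [r]) = r"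
      "set xs \<subseteq> {v. (adjacent E)\<^sup>*\<^sup>* r v}" using relpowp_walk[OF walk] by blast
    then have "xs \<noteq> []" using \<open>odd n\<close> by auto
    then have "hd xs = r" using xs(3) by simp
    moreover have "{v} \<notin> E" for v using card2[of "{v}"] by auto
    ultimately show False using odd_closed_walk_contains_odd_cycle[of E xs] xs \<open>odd n\<close> no by blast
  qed
  have "card e = 2" "e \<in> E" using card2 e by (auto simp: induced_edges_def)
  then obtain a b where ab: "e = {a, b}" by (auto simp: card_2_iff)
  with e have "(adjacent E)\<^sup>*\<^sup>* r a" "(adjacent E)\<^sup>*\<^sup>* r b" by (auto simp: induced_edges_def)
  then obtain na nb where n: "((adjacent E) ^^ na) r a" "((adjacent E) ^^ nb) r b"
    by (meson rtranclp_imp_relpowp)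
  \<comment> \<open>A walk to \<open>a\<close>, the edge to \<open>b\<close> and a walk back form a
    closed walk at \<open>r\<close>, of length \<open>i + 1 + j\<close>.\<close>
  have par: "odd (i + j)" if "((adjacent E) ^^ i) r a" "((adjacent E) ^^ j) r b" for i j
  proof -
    have "((adjacent E) ^^ Suc i) r b" using that(1) \<open>e \<in> E\<close> ab by auto
    from relpowp_trans[OF this relpowp_adjacent_sym[OF that(2)]]
    have "even (Suc i + j)" by (rule even)
    then show ?thesis by simp
  qed
  show ?thesis
  proof (cases "even na")
    case True
    then have "a \<in> A" using n(1) A by blast
    moreover have "b \<notin> A" unfolding A using par[OF n(1)] True by auto
    ultimately show ?thesis using ab by blast
  next
    case False
    then have "even nb" using par[OF n] by simp
    then have "b \<in> A" using n(2) A by blast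
    moreover have "a \<notin> A" unfolding A using par[OF _ n(2)] \<open>even nb\<close> by auto
    ultimately show ?thesis using ab by blast
  qed
qed

section \<open>Critical multisets\<close>

text \<open>The multisets of vertices visited by a closed walk of odd length have this property.\<close>

definition critical :: "'v set set \<Rightarrow> nat \<Rightarrow> 'v multiset \<Rightarrow> bool" where
  "critical E m a \<longleftrightarrow> size a = 2 * m + 1 \<and>
    (\<forall>u\<in>#a. matched E m (a - {#u#}) \<and> matched E (Suc m) (add_mset u a))"

lemma matched_path:
  "successively (adjacent E) xs \<Longrightarrow> even (length xs) \<Longrightarrow> matched E (length xs div 2) (mset xs)"
proof (induction xs rule: induct_list012)
  case (3 x y zs)
  then have "matched E (length zs div 2) (mset zs)" "{x, y} \<in> E"
    by (auto simp: successively_Cons)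
  then show ?case using matched_Suc by fastforce
qed (auto intro: matched_0)

text \<open>Rotated to begin at \<open>u\<close>, the cycle leaves a path on \<open>2 * m\<close>
  vertices once \<open>u\<close> is removed, and a walk with \<open>2 * m + 2\<close> entries once
  \<open>u\<close> is repeated at the end. Every second step of either gives an edge.\<close>

lemma odd_cycle_critical:
  assumes "graph_cycle E vs" "length vs = 2 * m + 1"
  shows "critical E m (mset vs)"
  unfolding critical_def
proof (intro conjI ballI)
  fix u assume "u \<in># mset vs"
  then obtain as bs where vs: "vs = as @ u # bs" by (auto dest: split_list)
  have s: "successively (adjacent E) ((u # bs @ as) @ [u])"
  proof (cases "as = []")
    case True
    then show ?thesis using assms(1) by (simp add: graph_cycle_iff vs)
  next
    case False
    then have "successively (adjacent E) (as @ (u # bs) @ [hd as])"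
      using assms(1) by (simp add: graph_cycle_iff vs)
    then have "successively (adjacent E) ((u # bs) @ (as @ [u]))"
      unfolding successively_append_iff using False by auto
    then show ?thesis by simp
  qed
  then have "successively (adjacent E) ([u] @ (bs @ as) @ [u])" by simp
  then have "successively (adjacent E) (bs @ as)" unfolding successively_append_iff by blast
  moreover have "length (bs @ as) = 2 * m" using assms(2) by (simp add: vs)
  ultimately show "matched E m (mset vs - {#u#})"
    using matched_path[of E "bs @ as"] by (simp add: vs add.commute)
  have "length ((u # bs @ as) @ [u]) = 2 * Suc m" using assms(2) by (simp add: vs)
  then show "matched E (Suc m) (add_mset u (mset vs))"
    using matched_path[OF s] by (simp add: vs add.commute)
qed (use assms in simp)

text \<open>The closed walk makes a detour from \<open>u\<close> to \<open>v\<close> and back, which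
  adds one copy of each.\<close>

lemma critical_extend:
  assumes "critical E m a" "u \<in># a" "{u, v} \<in> E"
  shows "critical E (Suc m) ({#u, v#} + a)"
  unfolding critical_def
proof (intro conjI ballI)
  fix w assume w: "w \<in># {#u, v#} + a"
  note c = assms(1)[unfolded critical_def]
  have "matched E (Suc m) ({#u, v#} + a - {#w#}) \<and> matched E (Suc (Suc m)) (add_mset w ({#u, v#} + a))"
  proof (cases "w \<in># a")
    case True
    then have *: "matched E m (a - {#w#})" "matched E (Suc m) (add_mset w a)" using c by auto
    have "{#u, v#} + a - {#w#} = {#u, v#} + (a - {#w#})" using True by (simp add: multiset_diff_union_assoc)
    moreover have "add_mset w ({#u, v#} + a) = {#u, v#} + add_mset w a" by simp
    ultimately show ?thesis using *[THEN matched_Suc[OF assms(3)]] by (simp only:)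
  next
    case False
    \<comment> \<open>Only the new vertex \<open>v\<close> remains. Removing it leaves
      \<open>a\<close> with \<open>u\<close> added once more; doubling it lets the two copies of
      \<open>v\<close> pair with two copies of \<open>u\<close>.\<close>
    then have wv: "w = v" using w assms(2) by auto
    have *: "matched E m (a - {#u#})" "matched E (Suc m) (add_mset u a)" using c assms(2) by auto
    have "{#u, v#} + a - {#w#} = add_mset u a" by (simp add: wv)
    moreover have "add_mset w ({#u, v#} + a) = {#u, v#} + ({#u, v#} + (a - {#u#}))"
      using assms(2) by (simp add: wv)
    ultimately show ?thesis using *(2) matched_Suc[OF assms(3) matched_Suc[OF assms(3) *(1)]] by (simp only:)
  qed
  then show "matched E (Suc m) ({#u, v#} + a - {#w#})" "matched E (Suc (Suc m)) (add_mset w ({#u, v#} + a))"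
    by auto
qed (use assms in \<open>simp add: critical_def\<close>)

text \<open>One detour per step of the path carries the support to \<open>v\<close>; the set
  \<open>D\<close>, closed under adjacency, confines it to a component.\<close>

lemma critical_reach:
  assumes "(adjacent E)\<^sup>*\<^sup>* u v" "critical E m a" "u \<in># a"
    "set_mset a \<subseteq> D" "\<And>x y. x \<in> D \<Longrightarrow> {x, y} \<in> E \<Longrightarrow> y \<in> D"
  shows "\<exists>m' a'. critical E m' a' \<and> set_mset a \<subseteq> set_mset a' \<and> v \<in># a' \<and> set_mset a' \<subseteq> D"
  using assms(1)
proof (induction rule: rtranclp_induct)
  case base
  then show ?case using assms by blast
next
  case (step x y)
  then obtain m' a' where a': "critical E m' a'" "set_mset a \<subseteq> set_mset a'" "x \<in># a'" "set_mset a' \<subseteq> D"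
    by blast
  have "critical E (Suc m') ({#x, y#} + a')" using critical_extend a' step.hyps by metis
  moreover have "set_mset ({#x, y#} + a') \<subseteq> D" using a'(3,4) assms(5) step.hyps by auto
  ultimately show ?case using a'(2)
    by (intro exI[of _ "Suc m'"] exI[of _ "{#x, y#} + a'"]) auto
qed

text \<open>Starting from the odd cycle, the vertices of \<open>C\<close> are attached one after the
  other by detours from \<open>hd vs\<close>, which stays in the support.\<close>

lemma critical_component:
  assumes "finite C" "C = {v. (adjacent E)\<^sup>*\<^sup>* r v}" "contains_odd_cycle C E"
  shows "\<exists>m a. critical E m a \<and> set_mset a = C"
proof -
  obtain vs where vs: "graph_cycle E vs" "set vs \<subseteq> C" "odd (length vs)"
    using assms(3) by (auto simp: contains_odd_cycle_def)
  obtain m where "length vs = 2 * m + 1" using vs(3) oddE by blast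
  then have c: "critical E m (mset vs)" using odd_cycle_critical vs(1) by blast
  have "vs \<noteq> []" using vs(3) by auto
  then have s: "hd vs \<in># mset vs" by simp
  have reach: "(adjacent E)\<^sup>*\<^sup>* (hd vs) v" if "v \<in> C" for v
    using that s vs(2) assms(2) by (auto intro: rtranclp_trans reachable_sym)
  have closed: "y \<in> C" if "x \<in> C" "{x, y} \<in> E" for x y
    using that assms(2) by (auto intro: rtranclp.rtrancl_into_rtrancl)
  have "\<exists>m a. critical E m a \<and> insert (hd vs) F \<subseteq> set_mset a \<and> set_mset a \<subseteq> C" if "finite F" "F \<subseteq> C" for F
    using that
  proof (induction F rule: finite_induct)
    case empty
    show ?case by (intro exI[of _ m] exI[of _ "mset vs"]) (use c s vs(2) in auto)
  next
    case (insert x F)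
    then obtain m a where a: "critical E m a" "insert (hd vs) F \<subseteq> set_mset a" "set_mset a \<subseteq> C" by blast
    have "x \<in> C" "hd vs \<in># a" using insert.prems a(2) by auto
    then have "\<exists>m' a'. critical E m' a' \<and> set_mset a \<subseteq> set_mset a' \<and> x \<in># a' \<and> set_mset a' \<subseteq> C"
      by (intro critical_reach[OF reach a(1) _ a(3)]) (auto intro: closed)
    then show ?case using a(2) by (metis insert_subset subset_trans)
  qed
  from this[OF assms(1)] show ?thesis by blast
qed

section \<open>Size bound and matchings into copies of a vertex set\<close>

lemma matched_size: "matched E k a \<Longrightarrow> 2 * k \<le> size a"
  by (induction rule: matched.induct) auto

text \<open>Every element of \<open>a\<close> takes its own copy of a neighbour in \<open>Z\<close>;
  \<open>n\<close> copies of \<open>Z\<close> suffice even if all choose the same neighbour.\<close>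

lemma matched_saturate:
  assumes "finite Z" "set_mset a \<subseteq> neighbours E Z" "size a \<le> n"
  shows "matched E (size a) (a + repeat_mset n (mset_set Z))"
  using assms(2,3)
proof (induction a arbitrary: n)
  case empty
  then show ?case by (simp add: matched_0)
next
  case (add v a)
  then obtain z where z: "z \<in> Z" "{v, z} \<in> E" by (auto simp: neighbours_def insert_commute)
  obtain n' where n': "n = Suc n'" using add.prems(2) by (cases n) auto
  have "matched E (size a) (a + repeat_mset n' (mset_set Z))" using add n' by auto
  from matched_add_mset[OF z(2) this] have "matched E (size (add_mset v a))
    (add_mset v (add_mset z (a + repeat_mset n' (mset_set Z))))" by simp
  moreover have "{#z#} \<subseteq># mset_set Z" using z(1) assms(1) by simp
  then have "add_mset v (add_mset z (a + repeat_mset n' (mset_set Z))) \<subseteq># add_mset v a + repeat_mset n (mset_set Z)"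
    by (auto simp: n' subseteq_mset_def split: if_splits)
  ultimately show ?case using matched_mono by blast
qed

text \<open>Serves to exclude edges inside \<open>Z\<close>: otherwise a high power of the variables
  in \<open>Z\<close> would contain arbitrarily many edges.\<close>

lemma matched_repeat:
  assumes "finite Z" "x \<in> Z" "y \<in> Z" "x \<noteq> y" "{x, y} \<in> E"
  shows "matched E n (repeat_mset n (mset_set Z))"
proof (induction n)
  case (Suc n)
  have "{#x, y#} \<subseteq># mset_set Z"
    using assms by (auto simp: subseteq_mset_def)
  then have "{#x, y#} + repeat_mset n (mset_set Z) \<subseteq># mset_set Z + repeat_mset n (mset_set Z)"
    by (rule mset_subset_eq_mono_add) simp
  then have "{#x, y#} + repeat_mset n (mset_set Z) \<subseteq># repeat_mset (Suc n) (mset_set Z)"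
    by (simp only: repeat_mset_Suc)
  then show ?case using matched_Suc[OF assms(5) Suc] matched_mono by blast
qed (simp add: matched_0)

section \<open>Components and the combinatorial criterion\<close>

lemma graph_componentsE:
  assumes "C \<in> graph_components W (induced_edges E W)"
  obtains r where "r \<in> W" "C = {v. (adjacent (induced_edges E W))\<^sup>*\<^sup>* r v}" "r \<in> C" "C \<subseteq> W"
proof -
  obtain r where r: "r \<in> W" "C = {v \<in> W. (adjacent (induced_edges E W))\<^sup>*\<^sup>* r v}"
    using assms by (auto simp: graph_components_def)
  have "v \<in> W" if "(adjacent (induced_edges E W))\<^sup>*\<^sup>* r v" for v
    using that r(1) by (cases rule: rtranclp.cases) (auto simp: induced_edges_def)
  then show ?thesis using r by (intro that[of r]) auto
qed

lemma graph_components_closed: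
  assumes "C \<in> graph_components W (induced_edges E W)" "e \<in> E" "e \<subseteq> W" "e \<inter> C \<noteq> {}"
    and "card e = 2"
  shows "e \<subseteq> C"
proof -
  obtain r where C: "C = {v. (adjacent (induced_edges E W))\<^sup>*\<^sup>* r v}" using graph_componentsE[OF assms(1)] by metis
  have closed: "y \<in> C" if "x \<in> C" "{x, y} \<in> induced_edges E W" for x y
    using that C by (auto intro: rtranclp.rtrancl_into_rtrancl)
  obtain x y where "e = {x, y}" using assms(5) by (auto simp: card_2_iff)
  then show ?thesis using closed[of x y] closed[of y x] assms(2-4)
    by (auto simp: induced_edges_def insert_commute)
qed

lemma graph_components_disjoint:
  assumes "C \<in> graph_components W (induced_edges E W)" "C' \<in> graph_components W (induced_edges E W)" "C \<noteq> C'"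
  shows "C \<inter> C' = {}"
proof (rule ccontr)
  assume "C \<inter> C' \<noteq> {}"
  then obtain x where x: "x \<in> C" "x \<in> C'" by blast
  let ?R = "(adjacent (induced_edges E W))\<^sup>*\<^sup>*"
  obtain r where r: "C = {v. ?R r v}" using graph_componentsE[OF assms(1)] by metis
  obtain r' where r': "C' = {v. ?R r' v}" using graph_componentsE[OF assms(2)] by metis
  have "?R r r'" "?R r' r"
    using x r r' reachable_sym[of _ r x] reachable_sym[of _ r' x] by (auto intro: rtranclp_trans)
  then have "C = C'" using r r' by (auto intro: rtranclp_trans)
  then show False using assms(3) by blast
qed

lemma Union_graph_components: "\<Union> (graph_components W E) = W"
  by (auto simp: graph_components_def)

lemma edge_outside_neighbours:
  assumes "coclique E Z" "\<And>e. e \<in> E \<Longrightarrow> card e = 2" "e \<in> E"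
    "e \<inter> neighbours E Z = {}"
  shows "e \<subseteq> - Z - neighbours E Z"
proof -
  obtain x y where "e = {x, y}" using assms(2)[OF assms(3)] by (auto simp: card_2_iff)
  then show ?thesis using assms by (auto simp: neighbours_def coclique_def insert_commute)
qed

text \<open>Without an odd cycle \<open>C\<close> is bipartite, and Koenig's theorem yields a cover
  \<open>S\<close> of its edges whose weight is attained by a matching of the part of
  \<open>w\<close> in \<open>C\<close>. Enlarging \<open>w\<close> at a vertex \<open>u\<close> of
  \<open>C\<close> outside \<open>S\<close> leaves that weight unchanged, so the \<open>k\<close>
  edges found there can be replaced by \<open>k\<close> edges in \<open>w\<close> and the copies of
  \<open>Z\<close>, against \<open>nm\<close>.\<close>

lemma components_contain_odd_cycle:
  fixes E :: "'v::finite set set" and Z :: "'v set"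
  defines "W \<equiv> - Z - neighbours E Z"
  assumes card2: "\<And>e. e \<in> E \<Longrightarrow> card e = 2" and co: "coclique E Z"
    and n: "size w \<le> n"
    and nm: "\<not> matched E k (w + repeat_mset n (mset_set Z))"
    and all: "\<And>u. u \<in> - Z \<Longrightarrow> matched E k (add_mset u w)"
    and C: "C \<in> graph_components W (induced_edges E W)"
  shows "contains_odd_cycle C (induced_edges E W)"
proof (rule ccontr)
  assume no: "\<not> contains_odd_cycle C (induced_edges E W)"
  obtain r where r: "C = {v. (adjacent (induced_edges E W))\<^sup>*\<^sup>* r v}" "r \<in> C" "C \<subseteq> W"
    using graph_componentsE[OF C] by metis
  define A where "A = {v. \<exists>n. even n \<and> ((adjacent (induced_edges E W)) ^^ n) r v}"
  define F where "F = induced_edges E C"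
  have F_eq: "F = induced_edges (induced_edges E W) C" using r(3) by (auto simp: F_def induced_edges_def)
  have bip: "\<exists>a\<in>A. \<exists>b. b \<notin> A \<and> e = {a, b}" if "e \<in> F" for e
    using no_odd_cycle_bipartition[of "induced_edges E W" r e A] card2 no r(1) that A_def F_eq
    by (auto simp: induced_edges_def)
  define wC where "wC = {#x \<in># w. x \<in> C#}"
  \<comment> \<open>If \<open>S\<close> contains all of \<open>C\<close>, a matching of size
    \<open>size wC\<close> forces \<open>wC\<close> to be empty, since each edge takes two elements.
    Then any cover serves, and a colour class that misses \<open>r\<close> is one.\<close>
  obtain S u where S: "\<And>e. e \<in> F \<Longrightarrow> e \<inter> S \<noteq> {}" "matched F (size {#x \<in># wC. x \<in> S#}) wC"
    and u: "u \<in> C" "u \<notin> S"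
  proof -
    obtain S where S: "\<forall>e\<in>F. e \<inter> S \<noteq> {}" "matched F (size {#x \<in># wC. x \<in> S#}) wC"
      using koenig_weighted[of F A wC] bip by blast
    show ?thesis
    proof (cases "C \<subseteq> S")
      case False
      then show ?thesis using S that by blast
    next
      case True
      then have "{#x \<in># wC. x \<in> S#} = wC" by (auto simp: wC_def filter_mset_eq_conv)
      then have "wC = {#}" using matched_size[OF S(2)] by simp
      then have triv: "matched F (size {#x \<in># wC. x \<in> T#}) wC" for T by (simp add: matched_0)
      show ?thesis
      proof (cases "r \<in> A")
        case True
        have "e \<inter> - A \<noteq> {}" if "e \<in> F" for e using bip[OF that] by auto
        then show ?thesis using that[OF _ triv r(2), of "- A"] True by blast
      next
        case False
        have "e \<inter> A \<noteq> {}" if "e \<in> F" for e using bip[OF that] by auto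
        then show ?thesis using that[OF _ triv r(2), of A] False by blast
      qed
    qed
  qed
  let ?N = "neighbours E Z" and ?D = "W - C"
  have uW: "u \<in> - Z" "u \<notin> ?N" using u r(3) by (auto simp: W_def)
  have "e \<inter> ?N \<noteq> {} \<or> e \<subseteq> C \<or> e \<subseteq> ?D" if e: "e \<in> E" for e
    using edge_outside_neighbours[OF co card2 e] graph_components_closed[OF C e _ _ card2[OF e]] unfolding W_def by blast
  from matched_split[OF all[OF uW(1)] this, simplified]
  obtain i j l where k: "k = i + j + l" "i \<le> size {#x \<in># add_mset u w. x \<in> ?N#}"
    "matched (induced_edges E C) j {#x \<in># add_mset u w. x \<in> C#}"
    "matched (induced_edges E ?D) l {#x \<in># add_mset u w. x \<in> ?D#}"
    by auto
  \<comment> \<open>As \<open>u\<close> is outside \<open>S\<close>, it does not count towards the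
    weight of the cover.\<close>
  have "j \<le> size {#x \<in># {#x \<in># add_mset u w. x \<in> C#}. x \<in> S#}"
    using matched_le_cover[OF k(3)] S(1) unfolding F_def by blast
  then have "j \<le> size {#x \<in># wC. x \<in> S#}" using u by (simp add: wC_def)
  then have j: "matched E j {#x \<in># w. x \<in> C#}"
    using matched_edges_mono[OF matched_le[OF S(2)]] by (auto simp: F_def wC_def induced_edges_def)
  have l: "matched E l {#x \<in># w. x \<in> ?D#}"
    using matched_edges_mono[OF k(4), of E] u(1) by (auto simp: induced_edges_def)
  have wN: "size {#x \<in># w. x \<in> ?N#} \<le> n"
    using n size_filter_mset_lesseq le_trans by blast
  have i: "matched E i ({#x \<in># w. x \<in> ?N#} + repeat_mset n (mset_set Z))"
    using matched_le[OF matched_saturate[OF _ _ wN]] k(2) uW(2) by auto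
  have "matched E k (({#x \<in># w. x \<in> ?N#} + repeat_mset n (mset_set Z)) + {#x \<in># w. x \<in> C#} + {#x \<in># w. x \<in> ?D#})"
    unfolding k(1) by (intro matched_add i j l)
  \<comment> \<open>The three parts of \<open>w\<close> are disjoint, because \<open>C\<close> lies
    in \<open>W\<close> and \<open>W\<close> avoids the neighbours of \<open>Z\<close>.\<close>
  moreover have "({#x \<in># w. x \<in> ?N#} + repeat_mset n (mset_set Z)) + {#x \<in># w. x \<in> C#} + {#x \<in># w. x \<in> ?D#}
    \<subseteq># w + repeat_mset n (mset_set Z)"
    using r(3) by (auto simp: subseteq_mset_def W_def)
  ultimately show False using nm matched_mono by blast
qed

text \<open>An edge meeting \<open>N\<close> uses an element of \<open>N\<close>; any other edge
  uses two elements of some \<open>C\<close> and so raises a rounded half.\<close>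

lemma matched_le_components:
  assumes "matched E k a" "finite P" "\<And>e. e \<in> E \<Longrightarrow> e \<inter> N \<noteq> {} \<or> (\<exists>C\<in>P. e \<subseteq> C)"
  shows "k \<le> size {#x \<in># a. x \<in> N#} + (\<Sum>C\<in>P. size {#x \<in># a. x \<in> C#} div 2)"
  using assms(1)
proof (induction rule: matched.induct)
  case (matched_Suc u v k a)
  let ?b = "{#u, v#} + a"
  have N: "size {#x \<in># a. x \<in> N#} \<le> size {#x \<in># ?b. x \<in> N#}" by simp
  have P: "size {#x \<in># a. x \<in> C#} div 2 \<le> size {#x \<in># ?b. x \<in> C#} div 2" for C
    by (intro div_le_mono) simp
  show ?case
  proof (cases "{u, v} \<inter> N = {}")
    case False
    then have "size {#x \<in># a. x \<in> N#} < size {#x \<in># ?b. x \<in> N#}" by auto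
    moreover have "(\<Sum>C\<in>P. size {#x \<in># a. x \<in> C#} div 2) \<le> (\<Sum>C\<in>P. size {#x \<in># ?b. x \<in> C#} div 2)"
      by (intro sum_mono P)
    ultimately show ?thesis using matched_Suc.IH by linarith
  next
    case True
    then obtain C where C: "C \<in> P" "{u, v} \<subseteq> C" using assms(3) matched_Suc.hyps by blast
    then have "size {#x \<in># a. x \<in> C#} div 2 < size {#x \<in># ?b. x \<in> C#} div 2" by simp
    then have "(\<Sum>C\<in>P. size {#x \<in># a. x \<in> C#} div 2) < (\<Sum>C\<in>P. size {#x \<in># ?b. x \<in> C#} div 2)"
      by (intro sum_strict_mono_ex1 assms(2) ballI P bexI[OF _ C(1)])
    then show ?thesis using matched_Suc.IH N by linarith
  qed
qed simp

text \<open>The witness joins a critical multiset for each component with one copy of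
  \<open>Z\<close>. Its size \<open>2 * m C + 1\<close> allows at most \<open>m C\<close> edges in
  \<open>C\<close>. An extra vertex of \<open>C\<close> yields one more edge by criticality, and an
  extra neighbour of \<open>Z\<close> pairs with a vertex of \<open>Z\<close>.\<close>

lemma ex_socle_multiset:
  fixes E :: "'v::finite set set" and Z :: "'v set"
  defines "W \<equiv> - Z - neighbours E Z"
  assumes card2: "\<And>e. e \<in> E \<Longrightarrow> card e = 2" and co: "coclique E Z"
    and odd: "\<And>C. C \<in> graph_components W (induced_edges E W) \<Longrightarrow> contains_odd_cycle C (induced_edges E W)"
  shows "\<exists>k w. (\<forall>b. set_mset b \<subseteq> Z \<longrightarrow> \<not> matched E (Suc k) (w + b)) \<and>
    (\<forall>u\<in>- Z. matched E (Suc k) (add_mset u w))"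
proof -
  let ?F = "induced_edges E W" and ?N = "neighbours E Z"
  define P where "P = graph_components W ?F"
  have "\<exists>m a. critical ?F m a \<and> set_mset a = C" if C: "C \<in> P" for C
  proof -
    obtain r where "C = {v. (adjacent ?F)\<^sup>*\<^sup>* r v}" using graph_componentsE C P_def by metis
    then show ?thesis using critical_component[of C ?F r] odd C P_def by simp
  qed
  then obtain m a where crit: "\<And>C. C \<in> P \<Longrightarrow> critical ?F (m C) (a C)"
    and set_a: "\<And>C. C \<in> P \<Longrightarrow> set_mset (a C) = C" by metis
  have FE: "?F \<subseteq> E" by (auto simp: induced_edges_def)
  have PW: "C \<subseteq> W" if "C \<in> P" for C using that Union_graph_components[of W ?F] by (auto simp: P_def)
  have match: "matched E (m C) (a C)" if C: "C \<in> P" for C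
  proof -
    obtain u where "u \<in># a C" using crit[OF C] by (cases "a C") (auto simp: critical_def)
    then have "matched ?F (m C) (a C - {#u#})" using crit[OF C] by (simp add: critical_def)
    then show ?thesis using matched_edges_mono[OF matched_mono FE] by (meson diff_subset_eq_self)
  qed
  define k where "k = (\<Sum>C\<in>P. m C)"
  define t where "t = (\<Sum>C\<in>P. a C)"
  have remove: "k = m C + (\<Sum>C\<in>P - {C}. m C)" "t = a C + (\<Sum>C\<in>P - {C}. a C)" if "C \<in> P" for C
    using that by (simp_all add: k_def t_def sum.remove)
  have "\<not> matched E (Suc k) (t + mset_set Z + b)" if b: "set_mset b \<subseteq> Z" for b
  proof
    assume M: "matched E (Suc k) (t + mset_set Z + b)"
    have disj: "Z \<inter> ?N = {}" using co by (auto simp: coclique_def neighbours_def)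
    have set_t: "set_mset t \<subseteq> W" unfolding t_def using set_a PW by (auto simp: set_mset_sum)
    \<comment> \<open>No available vertex lies in \<open>neighbours E Z\<close>, so only edges
      inside components count.\<close>
    have N0: "{#x \<in># t + mset_set Z + b. x \<in> ?N#} = {#}"
      by (subst filter_mset_eq_conv) (use set_t b disj in \<open>auto simp: W_def\<close>)
    have size_C: "size {#x \<in># t + mset_set Z + b. x \<in> C#} div 2 = m C" if C: "C \<in> P" for C
    proof -
      have "x \<notin> C" if "x \<in># (\<Sum>C\<in>P - {C}. a C)" for x
        using that graph_components_disjoint[of _ W E C] C set_a unfolding P_def by (fastforce simp: set_mset_sum)
      moreover have "x \<notin> C" if "x \<in># mset_set Z + b" for x
        using that b PW[OF C] by (auto simp: W_def)
      moreover define R where "R = (\<Sum>C\<in>P - {C}. a C) + (mset_set Z + b)"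
      ultimately have "x \<notin> C" if "x \<in># R" for x using that by (auto simp: R_def)
      then have "{#x \<in># a C + R. x \<in> C#} = a C"
        by (subst filter_mset_eq_conv) (use set_a[OF C] in auto)
      then have "{#x \<in># t + mset_set Z + b. x \<in> C#} = a C"
        unfolding remove(2)[OF C] R_def by (simp only: add.assoc)
      then show ?thesis using crit[OF C] by (simp add: critical_def)
    qed
    have edges: "e \<inter> ?N \<noteq> {} \<or> (\<exists>C\<in>P. e \<subseteq> C)" if e: "e \<in> E" for e
    proof (cases "e \<inter> ?N = {}")
      case True
      then have eW: "e \<subseteq> W" using edge_outside_neighbours[OF co card2 e] by (simp add: W_def)
      have "e \<noteq> {}" using card2[OF e] by auto
      then obtain C where "C \<in> P" "e \<inter> C \<noteq> {}" using eW Union_graph_components[of W ?F] unfolding P_def by blast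
      then show ?thesis using graph_components_closed[OF _ e eW _ card2[OF e]] unfolding P_def by blast
    qed simp
    have "Suc k \<le> size {#x \<in># t + mset_set Z + b. x \<in> ?N#} +
        (\<Sum>C\<in>P. size {#x \<in># t + mset_set Z + b. x \<in> C#} div 2)"
      by (rule matched_le_components[OF M finite edges])
    also have "\<dots> = k" unfolding N0 k_def size_empty add_0 by (intro sum.cong refl size_C)
    finally show False by simp
  qed
  moreover have "matched E (Suc k) (add_mset u (t + mset_set Z))" if u: "u \<in> - Z" for u
  proof (cases "u \<in> W")
    case True
    then obtain C where C: "C \<in> P" "u \<in> C" using Union_graph_components[of W ?F] unfolding P_def by blast
    then have "matched ?F (Suc (m C)) (add_mset u (a C))" using crit set_a by (auto simp: critical_def)
    then have "matched E (Suc (m C) + (\<Sum>C\<in>P - {C}. m C)) (add_mset u (a C) + (\<Sum>C\<in>P - {C}. a C))"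
      by (intro matched_add matched_sum match matched_edges_mono[OF _ FE]) auto
    then have "matched E (Suc k) (add_mset u t)" using remove[OF C(1)] by simp
    then show ?thesis by (rule matched_mono) simp
  next
    case False
    then obtain z where z: "z \<in> Z" "{u, z} \<in> E" using u by (auto simp: W_def neighbours_def insert_commute)
    have "matched E k t" unfolding k_def t_def by (intro matched_sum match) auto
    from matched_add_mset[OF z(2) this] have "matched E (Suc k) (add_mset u (add_mset z t))" .
    moreover have "{#z#} \<subseteq># mset_set Z" using z(1) by simp
    then have "t + {#z#} \<subseteq># t + mset_set Z" by (rule subset_mset.add_left_mono)
    then have "add_mset u (add_mset z t) \<subseteq># add_mset u (t + mset_set Z)" by simp
    ultimately show ?thesis using matched_mono by blast
  qed
  ultimately have "(\<forall>b. set_mset b \<subseteq> Z \<longrightarrow> \<not> matched E (Suc k) (t + mset_set Z + b)) \<and>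
    (\<forall>u\<in>- Z. matched E (Suc k) (add_mset u (t + mset_set Z)))" by blast
  then have "\<exists>w. (\<forall>b. set_mset b \<subseteq> Z \<longrightarrow> \<not> matched E (Suc k) (w + b)) \<and>
    (\<forall>u\<in>- Z. matched E (Suc k) (add_mset u w))" by (rule exI)
  then show ?thesis by (rule exI)
qed

section \<open>Monomial ideals\<close>

lemma mpoly_ring_simps [simp]:
  "carrier (mpoly_ring :: ('v, 'k::field) mpoly ring) = UNIV"
  "x \<otimes>\<^bsub>mpoly_ring\<^esub> y = x * (y :: ('v, 'k::field) mpoly)"
  "x \<oplus>\<^bsub>mpoly_ring\<^esub> y = x + (y :: ('v, 'k::field) mpoly)"
  "\<zero>\<^bsub>mpoly_ring\<^esub> = (0 :: ('v, 'k::field) mpoly)"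
  "\<one>\<^bsub>mpoly_ring\<^esub> = (1 :: ('v, 'k::field) mpoly)"
  by (simp_all add: ring_of_type_algebra_def)

lemma cring_mpoly: "cring (mpoly_ring :: ('v, 'k::field) mpoly ring)"
  by (rule cring_from_type_algebra)

lemma ring_mpoly: "ring (mpoly_ring :: ('v, 'k::field) mpoly ring)"
  by (rule ring_from_type_algebra)

lemma a_inv_mpoly: "\<ominus>\<^bsub>mpoly_ring\<^esub> x = - (x :: ('v, 'k::field) mpoly)"
proof -
  interpret ring "mpoly_ring :: ('v, 'k) mpoly ring" by (rule ring_mpoly)
  show ?thesis by (rule minus_equality) simp_all
qed

section \<open>Coefficients of products\<close>

lemma sum_singles: "(\<Sum>a\<in>Poly_Mapping.keys f. Poly_Mapping.single a (Poly_Mapping.lookup f a)) = f"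
  by (rule poly_mapping_eqI)
    (auto simp: lookup_sum lookup_single when_def sum.delta' in_keys_iff)

lemma lookup_mult_keys:
  fixes f g :: "'a::monoid_add \<Rightarrow>\<^sub>0 'b::semiring_0"
  shows "Poly_Mapping.lookup (f * g) k = (\<Sum>(a, b)\<in>Poly_Mapping.keys f \<times> Poly_Mapping.keys g.
    Poly_Mapping.lookup f a * Poly_Mapping.lookup g b when k = a + b)"
proof -
  have "f * g = (\<Sum>(a, b)\<in>Poly_Mapping.keys f \<times> Poly_Mapping.keys g.
    Poly_Mapping.single (a + b) (Poly_Mapping.lookup f a * Poly_Mapping.lookup g b))"
    by (subst (1 2) sum_singles[symmetric]) (simp add: sum_product mult_single sum.cartesian_product)
  then have "Poly_Mapping.lookup (f * g) k = (\<Sum>x\<in>Poly_Mapping.keys f \<times> Poly_Mapping.keys g.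
    Poly_Mapping.lookup (case x of (a, b) \<Rightarrow>
      Poly_Mapping.single (a + b) (Poly_Mapping.lookup f a * Poly_Mapping.lookup g b)) k)"
    by (simp only: lookup_sum)
  then show ?thesis by (simp add: case_prod_unfold lookup_single when_def eq_commute)
qed

text \<open>Only one term of the convolution survives. This serves both for multiplication by a
  single term and, with \<open>ex_unique_sum\<close>, for primality.\<close>

lemma lookup_mult_unique:
  fixes f g :: "'a::monoid_add \<Rightarrow>\<^sub>0 'b::semiring_0"
  assumes "\<And>a b. a \<in> Poly_Mapping.keys f \<Longrightarrow> b \<in> Poly_Mapping.keys g \<Longrightarrow> a + b = s + t \<Longrightarrow> a = s \<and> b = t"
    and "s \<in> Poly_Mapping.keys f" "t \<in> Poly_Mapping.keys g"
  shows "Poly_Mapping.lookup (f * g) (s + t) = Poly_Mapping.lookup f s * Poly_Mapping.lookup g t"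
proof -
  have "Poly_Mapping.lookup (f * g) (s + t) = (\<Sum>x\<in>Poly_Mapping.keys f \<times> Poly_Mapping.keys g.
    if x = (s, t) then Poly_Mapping.lookup f s * Poly_Mapping.lookup g t else 0)"
    unfolding lookup_mult_keys
  proof (intro sum.cong refl)
    fix x assume "x \<in> Poly_Mapping.keys f \<times> Poly_Mapping.keys g"
    then obtain a b where "x = (a, b)" "a \<in> Poly_Mapping.keys f" "b \<in> Poly_Mapping.keys g" by blast
    then show "(case x of (a, b) \<Rightarrow> Poly_Mapping.lookup f a * Poly_Mapping.lookup g b when s + t = a + b) =
      (if x = (s, t) then Poly_Mapping.lookup f s * Poly_Mapping.lookup g t else 0)"
      using assms(1)[of a b] by (auto simp: when_def)
  qed
  also have "\<dots> = Poly_Mapping.lookup f s * Poly_Mapping.lookup g t"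
    using assms(2,3) by (simp add: sum.delta')
  finally show ?thesis .
qed

lemma keys_single_mult:
  fixes f :: "'a::cancel_comm_monoid_add \<Rightarrow>\<^sub>0 'b::idom"
  assumes "c \<noteq> 0" "t \<in> Poly_Mapping.keys f"
  shows "s + t \<in> Poly_Mapping.keys (Poly_Mapping.single s c * f)"
  using lookup_mult_unique[of "Poly_Mapping.single s c" f s t] assms
  by (simp add: in_keys_iff)

text \<open>Identifies exponent vectors with multisets of vertices, which turns divisibility of
  monomials into multiset inclusion.\<close>

definition exp_mset :: "('v \<Rightarrow>\<^sub>0 nat) \<Rightarrow> 'v multiset" where
  "exp_mset t = Abs_multiset (Poly_Mapping.lookup t)"

lemma count_exp_mset [simp]: "count (exp_mset t) v = Poly_Mapping.lookup t v"
  unfolding exp_mset_def by (subst count_Abs_multiset) auto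

lemma exp_mset_add [simp]: "exp_mset (s + t) = exp_mset s + exp_mset t"
  by (rule multiset_eqI) (simp add: lookup_add)

lemma exp_mset_single [simp]: "exp_mset (Poly_Mapping.single v (Suc 0)) = {#v#}"
  by (rule multiset_eqI) (simp add: lookup_single when_def)

lemma exp_mset_zero [simp]: "exp_mset 0 = {#}"
  by (rule multiset_eqI) simp

lemma exp_mset_inject [simp]: "exp_mset s = exp_mset t \<longleftrightarrow> s = t"
  by (auto simp: multiset_eq_iff intro: poly_mapping_eqI)

lemma exp_mset_surj: obtains t where "exp_mset t = a"
proof
  show "exp_mset (Abs_poly_mapping (count a)) = a"
    by (rule multiset_eqI) (simp add: lookup_Abs_poly_mapping)
qed

text \<open>For \<open>M\<close> closed under adding exponents this is the ideal spanned by the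
  monomials in \<open>M\<close>.\<close>

definition monomial_ideal :: "('v \<Rightarrow>\<^sub>0 nat) set \<Rightarrow> ('v, 'k::field) mpoly set" where
  "monomial_ideal M = {f. Poly_Mapping.keys f \<subseteq> M}"

lemma ideal_monomial_ideal:
  assumes up: "\<And>s t. s \<in> M \<Longrightarrow> s + t \<in> M"
  shows "ideal (monomial_ideal M :: ('v, 'k::field) mpoly set) mpoly_ring"
proof -
  interpret ring "mpoly_ring :: ('v, 'k) mpoly ring" by (rule ring_mpoly)
  have mult: "f * g \<in> monomial_ideal M" if "f \<in> monomial_ideal M" for f g :: "('v, 'k) mpoly"
    using that keys_mult[of f g] up by (fastforce simp: monomial_ideal_def)
  show ?thesis
  proof (rule idealI)
    show "subgroup (monomial_ideal M) (add_monoid (mpoly_ring :: ('v, 'k) mpoly ring))"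
    proof (rule add.subgroupI)
      show "monomial_ideal M \<noteq> ({} :: ('v, 'k) mpoly set)"
        by (auto simp: monomial_ideal_def intro!: exI[of _ 0])
    next
      fix f :: "('v, 'k) mpoly" assume "f \<in> monomial_ideal M"
      then show "\<ominus>\<^bsub>mpoly_ring\<^esub> f \<in> monomial_ideal M"
        by (simp add: a_inv_mpoly monomial_ideal_def)
    next
      fix f g :: "('v, 'k) mpoly" assume "f \<in> monomial_ideal M" "g \<in> monomial_ideal M"
      then show "f \<oplus>\<^bsub>mpoly_ring\<^esub> g \<in> monomial_ideal M"
        using keys_add[of f g] by (auto simp: monomial_ideal_def)
    qed simp
  qed (use mult ring_mpoly in \<open>auto simp: mult.commute\<close>)
qed

lemma ideal_sum_closed:
  assumes "ideal I (mpoly_ring :: ('v, 'k::field) mpoly ring)" "\<And>x. x \<in> F \<Longrightarrow> h x \<in> I"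
  shows "sum h F \<in> I"
proof -
  interpret I: ideal I "mpoly_ring :: ('v, 'k) mpoly ring" by fact
  have "0 \<in> I" using additive_subgroup.zero_closed[OF ideal.axioms(1)[OF assms(1)]] by simp
  moreover have "x + y \<in> I" if "x \<in> I" "y \<in> I" for x y using additive_subgroup.a_closed[OF ideal.axioms(1)[OF assms(1)] that] by simp
  ultimately show ?thesis using assms(2)
    by (induction F rule: infinite_finite_induct) auto
qed

lemma monomial_ideal_subset:
  assumes "ideal I (mpoly_ring :: ('v, 'k::field) mpoly ring)"
    and "\<And>t c. t \<in> M \<Longrightarrow> Poly_Mapping.single t c \<in> I"
  shows "monomial_ideal M \<subseteq> I"
proof
  fix f :: "('v, 'k) mpoly" assume "f \<in> monomial_ideal M"
  then have "(\<Sum>a\<in>Poly_Mapping.keys f. Poly_Mapping.single a (Poly_Mapping.lookup f a)) \<in> I"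
    by (intro ideal_sum_closed assms) (auto simp: monomial_ideal_def)
  then show "f \<in> I" by (simp add: sum_singles)
qed

lemma genideal_monomials:
  "Idl\<^bsub>mpoly_ring\<^esub> ((\<lambda>a. Poly_Mapping.single a 1) ` A) =
    (monomial_ideal {a + t | a t. a \<in> A} :: ('v, 'k::field) mpoly set)" (is "?L = ?R")
proof
  interpret ring "mpoly_ring :: ('v, 'k) mpoly ring" by (rule ring_mpoly)
  have L: "ideal ?L (mpoly_ring :: ('v, 'k) mpoly ring)" by (rule genideal_ideal) simp
  show "?L \<subseteq> ?R"
  proof (rule genideal_minimal)
    show "ideal ?R (mpoly_ring :: ('v, 'k) mpoly ring)"
      by (rule ideal_monomial_ideal) (auto, metis add.assoc)
    show "(\<lambda>a. Poly_Mapping.single a 1) ` A \<subseteq> ?R"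
      by (auto simp: monomial_ideal_def) (metis add.right_neutral)
  qed
  show "?R \<subseteq> ?L"
  proof (rule monomial_ideal_subset[OF L])
    fix x and c :: 'k assume "x \<in> {a + t | a t. a \<in> A}"
    then obtain a t where x: "x = a + t" "a \<in> A" by blast
    have "Poly_Mapping.single a 1 \<in> ?L" using genideal_self[of "(\<lambda>a. Poly_Mapping.single a 1) ` A"] x(2) by auto
    from ideal.I_l_closed[OF L this, of "Poly_Mapping.single t c"]
    show "Poly_Mapping.single x c \<in> ?L" by (simp add: mult_single x(1) add.commute)
  qed
qed

text \<open>Cancellation in a product can only remove exponents, which gives one inclusion; products
  of single terms give the other.\<close>

lemma ideal_prod_monomial_ideal:
  assumes "\<And>s t. s \<in> M \<Longrightarrow> s + t \<in> M" "\<And>s t. s \<in> N \<Longrightarrow> s + t \<in> N"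
  shows "monomial_ideal M \<cdot>\<^bsub>mpoly_ring\<^esub> monomial_ideal N =
    (monomial_ideal {s + t | s t. s \<in> M \<and> t \<in> N} :: ('v, 'k::field) mpoly set)" (is "?L = ?R")
proof
  interpret ring "mpoly_ring :: ('v, 'k) mpoly ring" by (rule ring_mpoly)
  have L: "ideal ?L (mpoly_ring :: ('v, 'k) mpoly ring)"
    by (intro ideal_prod_is_ideal ideal_monomial_ideal assms)
  show "?L \<subseteq> ?R"
  proof
    fix f assume "f \<in> ?L"
    then show "f \<in> ?R"
    proof (induction rule: ideal_prod.induct)
      case (prod i j)
      then have "{a + b | a b. a \<in> Poly_Mapping.keys i \<and> b \<in> Poly_Mapping.keys j} \<subseteq>
        {s + t | s t. s \<in> M \<and> t \<in> N}" unfolding monomial_ideal_def by blast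
      then show ?case using keys_mult[of i j] by (simp add: monomial_ideal_def)
    next
      case (sum f g)
      then show ?case using keys_add[of f g] by (auto simp: monomial_ideal_def)
    qed
  qed
  show "?R \<subseteq> ?L"
  proof (rule monomial_ideal_subset[OF L])
    fix x and c :: 'k assume "x \<in> {s + t | s t. s \<in> M \<and> t \<in> N}"
    then obtain s t where x: "x = s + t" "s \<in> M" "t \<in> N" by blast
    have "Poly_Mapping.single s c \<otimes>\<^bsub>mpoly_ring\<^esub> Poly_Mapping.single t 1 \<in> ?L"
      by (rule ideal_prod.prod) (use x in \<open>auto simp: monomial_ideal_def\<close>)
    then show "Poly_Mapping.single x c \<in> ?L" by (simp add: mult_single x(1))
  qed
qed

section \<open>Powers of the edge ideal and ideals generated by variables\<close>

lemma matched_Suc_iff: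
  "matched E (Suc k) a \<longleftrightarrow> (\<exists>u v b. {u, v} \<in> E \<and> matched E k b \<and> a = {#u, v#} + b)"
  by (subst matched.simps) auto

lemma edge_ideal_eq:
  "(edge_ideal E :: ('v, 'k::field) mpoly set) = monomial_ideal {t. matched E 1 (exp_mset t)}"
proof -
  let ?A = "{Poly_Mapping.single i (1::nat) + Poly_Mapping.single j 1 | i j. {i, j} \<in> E}"
  have "{Var i * Var j | i j. {i, j} \<in> E} = (\<lambda>a. Poly_Mapping.single a 1 :: ('v, 'k) mpoly) ` ?A"
    by (auto simp: Var_def mult_single image_iff)
  moreover have "{a + t | a t. a \<in> ?A} = {t. matched E 1 (exp_mset t)}"
  proof (intro Set.equalityI subsetI)
    fix x assume "x \<in> {a + t | a t. a \<in> ?A}"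
    then obtain i j t where "{i, j} \<in> E" "x = Poly_Mapping.single i 1 + Poly_Mapping.single j 1 + t" by blast
    then show "x \<in> {t. matched E 1 (exp_mset t)}" using matched_Suc[OF _ matched_0, of i j E "exp_mset t"]
      by (simp add: add_mset_commute)
  next
    fix x assume "x \<in> {t. matched E 1 (exp_mset t)}"
    then obtain u v b where uv: "{u, v} \<in> E" "exp_mset x = {#u, v#} + b"
      using matched_Suc_iff[of E 0 "exp_mset x"] by auto
    obtain t where "exp_mset t = b" by (rule exp_mset_surj)
    then have "exp_mset x = exp_mset (Poly_Mapping.single u 1 + Poly_Mapping.single v 1 + t)" using uv by simp
    then have "x = Poly_Mapping.single u 1 + Poly_Mapping.single v 1 + t" by (simp only: exp_mset_inject)
    then show "x \<in> {a + t | a t. a \<in> ?A}" using uv(1) by blast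
  qed
  ultimately show ?thesis unfolding edge_ideal_def by (simp only: genideal_monomials)
qed

text \<open>Each further factor contributes one edge. The zeroth power is the whole ring, in
  agreement with \<open>matched_0\<close>.\<close>

lemma ideal_power_edge_ideal:
  "ideal_power mpoly_ring (edge_ideal E) k =
    (monomial_ideal {t. matched E k (exp_mset t)} :: ('v, 'k::field) mpoly set)"
proof (induction k)
  case 0
  then show ?case
    by (auto simp: nat_pow_def ideals_set_def monomial_ideal_def matched_0)
next
  case (Suc k)
  have up: "s + t \<in> {t. matched E j (exp_mset t)}" if "s \<in> {t. matched E j (exp_mset t)}" for s t j
    using that by (auto intro: matched_mono)
  have "ideal_power mpoly_ring (edge_ideal E) (Suc k) =
    ideal_power mpoly_ring (edge_ideal E) k \<cdot>\<^bsub>mpoly_ring\<^esub> (edge_ideal E :: ('v, 'k) mpoly set)"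
    by (simp add: nat_pow_def ideals_set_def)
  also have "\<dots> = monomial_ideal {s + t | s t. s \<in> {t. matched E k (exp_mset t)} \<and> t \<in> {t. matched E 1 (exp_mset t)}}"
    unfolding Suc.IH unfolding edge_ideal_eq by (intro ideal_prod_monomial_ideal up)
  also have "{s + t | s t. s \<in> {t. matched E k (exp_mset t)} \<and> t \<in> {t. matched E 1 (exp_mset t)}} =
    {t. matched E (Suc k) (exp_mset t)}"
  proof (intro Set.equalityI subsetI)
    fix x assume "x \<in> {s + t | s t. s \<in> {t. matched E k (exp_mset t)} \<and> t \<in> {t. matched E 1 (exp_mset t)}}"
    then show "x \<in> {t. matched E (Suc k) (exp_mset t)}" using matched_add[of E k _ 1] by auto
  next
    fix x assume "x \<in> {t. matched E (Suc k) (exp_mset t)}"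
    then obtain u v b where uv: "{u, v} \<in> E" "matched E k b" "exp_mset x = {#u, v#} + b"
      using matched_Suc_iff[of E k "exp_mset x"] by auto
    obtain s where s: "exp_mset s = b" by (rule exp_mset_surj)
    obtain t where t: "exp_mset t = {#u, v#}" by (rule exp_mset_surj)
    have "exp_mset x = exp_mset (s + t)" using uv s t by simp
    then have "x = s + t" by (simp only: exp_mset_inject)
    moreover have "matched E 1 (exp_mset t)" using matched_Suc[OF uv(1) matched_0, of "{#}"] t by simp
    ultimately show "x \<in> {s + t | s t. s \<in> {t. matched E k (exp_mset t)} \<and> t \<in> {t. matched E 1 (exp_mset t)}}"
      using uv(2) s by blast
  qed
  finally show ?case .
qed

lemma variable_ideal_eq:
  "(variable_ideal U :: ('v, 'k::field) mpoly set) = monomial_ideal {t. \<exists>u\<in>U. u \<in># exp_mset t}"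
proof -
  let ?A = "(\<lambda>u. Poly_Mapping.single u (1::nat)) ` U"
  have "Var ` U = (\<lambda>a. Poly_Mapping.single a 1 :: ('v, 'k) mpoly) ` ?A"
    by (simp add: Var_def image_image)
  moreover have "{a + t | a t. a \<in> ?A} = {t. \<exists>u\<in>U. u \<in># exp_mset t}"
  proof (intro Set.equalityI subsetI)
    fix x assume "x \<in> {t. \<exists>u\<in>U. u \<in># exp_mset t}"
    then obtain u b where u: "u \<in> U" "exp_mset x = {#u#} + b" by (auto dest!: multi_member_split)
    obtain t where "exp_mset t = b" by (rule exp_mset_surj)
    then have "exp_mset x = exp_mset (Poly_Mapping.single u 1 + t)" using u by simp
    then have "x = Poly_Mapping.single u 1 + t" by (simp only: exp_mset_inject)
    then show "x \<in> {a + t | a t. a \<in> ?A}" using u(1) by blast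
  qed auto
  ultimately show ?thesis unfolding variable_ideal_def by (simp only: genideal_monomials)
qed

text \<open>Replaces a monomial order, which is not available for an unordered set of indeterminates: the
  coefficient of the product at \<open>s + t\<close> is a product of two coefficients.\<close>

lemma ex_unique_sum:
  fixes S T :: "('v::finite \<Rightarrow>\<^sub>0 nat) set"
  assumes "finite S" "S \<noteq> {}" "finite T" "T \<noteq> {}"
  shows "\<exists>s\<in>S. \<exists>t\<in>T. \<forall>a\<in>S. \<forall>b\<in>T. a + b = s + t \<longrightarrow> a = s \<and> b = t"
proof -
  \<comment> \<open>Induction on a set \<open>D\<close> of coordinates outside which the elements of
    \<open>S\<close> agree with each other, and likewise those of \<open>T\<close>. Passing to the
    elements with maximal coordinate \<open>v\<close> makes them agree in \<open>v\<close>
    too.\<close>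
  have "\<exists>s\<in>S. \<exists>t\<in>T. \<forall>a\<in>S. \<forall>b\<in>T. a + b = s + t \<longrightarrow> a = s \<and> b = t"
    if "finite D" "finite S" "S \<noteq> {}" "finite T" "T \<noteq> {}"
      "\<forall>s\<in>S. \<forall>s'\<in>S. \<forall>v. v \<notin> D \<longrightarrow> Poly_Mapping.lookup s v = Poly_Mapping.lookup s' v"
      "\<forall>s\<in>T. \<forall>s'\<in>T. \<forall>v. v \<notin> D \<longrightarrow> Poly_Mapping.lookup s v = Poly_Mapping.lookup s' v"
    for D and S T :: "('v \<Rightarrow>\<^sub>0 nat) set"
    using that
  proof (induction D arbitrary: S T rule: finite_induct)
    case empty
    then have "a = a'" if "a \<in> S \<and> a' \<in> S \<or> a \<in> T \<and> a' \<in> T" for a a'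
      using that by (intro poly_mapping_eqI) blast
    then show ?case using empty.prems(2,4) by blast
  next
    case (insert v D)
    define top where "top Y = {s \<in> Y. \<forall>s'\<in>Y. Poly_Mapping.lookup s' v \<le> Poly_Mapping.lookup s v}"
      for Y :: "('v \<Rightarrow>\<^sub>0 nat) set"
    have top_ne: "top Y \<noteq> {}" if Y: "finite Y" "Y \<noteq> {}" for Y
    proof -
      have "Max ((\<lambda>s. Poly_Mapping.lookup s v) ` Y) \<in> (\<lambda>s. Poly_Mapping.lookup s v) ` Y"
        using Y by (intro Max_in) auto
      then obtain s where "s \<in> Y" "Max ((\<lambda>s. Poly_Mapping.lookup s v) ` Y) = Poly_Mapping.lookup s v" by auto
      then have "s \<in> top Y" using Y(1) Max_ge[of "(\<lambda>s. Poly_Mapping.lookup s v) ` Y"] by (auto simp: top_def)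
      then show ?thesis by blast
    qed
    have agree: "\<forall>s\<in>top Y. \<forall>s'\<in>top Y. \<forall>w. w \<notin> D \<longrightarrow> Poly_Mapping.lookup s w = Poly_Mapping.lookup s' w"
      if Y: "\<forall>s\<in>Y. \<forall>s'\<in>Y. \<forall>w. w \<notin> insert v D \<longrightarrow> Poly_Mapping.lookup s w = Poly_Mapping.lookup s' w" for Y
    proof (intro ballI allI impI)
      fix s s' w assume "s \<in> top Y" "s' \<in> top Y" "w \<notin> D"
      then show "Poly_Mapping.lookup s w = Poly_Mapping.lookup s' w"
        using Y by (cases "w = v") (auto simp: top_def intro: antisym)
    qed
    have "\<exists>s\<in>top S. \<exists>t\<in>top T. \<forall>a\<in>top S. \<forall>b\<in>top T. a + b = s + t \<longrightarrow> a = s \<and> b = t"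
      by (intro insert.IH top_ne agree insert.prems) (use insert.prems(1,3) in \<open>auto simp: top_def\<close>)
    then obtain s t where st: "s \<in> top S" "t \<in> top T"
      and un: "\<And>a b. a \<in> top S \<Longrightarrow> b \<in> top T \<Longrightarrow> a + b = s + t \<Longrightarrow> a = s \<and> b = t" by blast
    \<comment> \<open>The coordinate \<open>v\<close> of \<open>s + t\<close> is the largest
      possible one, so both \<open>a\<close> and \<open>b\<close> have to attain their
      maxima.\<close>
    have "a = s \<and> b = t" if ab: "a \<in> S" "b \<in> T" "a + b = s + t" for a b
    proof -
      have "Poly_Mapping.lookup a v + Poly_Mapping.lookup b v = Poly_Mapping.lookup s v + Poly_Mapping.lookup t v"
        using ab(3) by (metis lookup_add)
      moreover have "Poly_Mapping.lookup a v \<le> Poly_Mapping.lookup s v" "Poly_Mapping.lookup b v \<le> Poly_Mapping.lookup t v"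
        using st ab by (auto simp: top_def)
      ultimately have "Poly_Mapping.lookup a v = Poly_Mapping.lookup s v" "Poly_Mapping.lookup b v = Poly_Mapping.lookup t v"
        by linarith+
      then have "a \<in> top S" "b \<in> top T" using st ab by (auto simp: top_def)
      then show ?thesis using un ab(3) by blast
    qed
    then have un': "\<forall>a\<in>S. \<forall>b\<in>T. a + b = s + t \<longrightarrow> a = s \<and> b = t" by blast
    have "s \<in> S" "t \<in> T" using st by (auto simp: top_def)
    with un' show ?case by blast
  qed
  from this[of UNIV S T] show ?thesis using assms by simp
qed

text \<open>Terms of \<open>f\<close> and \<open>g\<close> in the ideal are dropped. If terms remain
  in both, some product of two of them is attained only once and survives in \<open>f * g\<close>,
  though no variable of \<open>U\<close> divides it.\<close>

lemma primeideal_variable_ideal: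
  "primeideal (variable_ideal U :: ('v::finite, 'k::field) mpoly set) mpoly_ring"
proof (rule primeidealI)
  let ?I = "variable_ideal U :: ('v, 'k) mpoly set"
  show "ideal ?I mpoly_ring" unfolding variable_ideal_eq by (rule ideal_monomial_ideal) auto
  show "cring (mpoly_ring :: ('v, 'k) mpoly ring)" by (rule cring_mpoly)
  have "1 \<notin> ?I" by (simp add: variable_ideal_eq monomial_ideal_def)
  then show "carrier mpoly_ring \<noteq> ?I" by auto
  fix f g :: "('v, 'k) mpoly"
  assume fg: "f \<otimes>\<^bsub>mpoly_ring\<^esub> g \<in> ?I"
  show "f \<in> ?I \<or> g \<in> ?I"
  proof (rule ccontr)
    assume neg: "\<not> (f \<in> ?I \<or> g \<in> ?I)"
    define S where "S h = {s \<in> Poly_Mapping.keys h. \<forall>u\<in>U. u \<notin># exp_mset s}" for h :: "('v, 'k) mpoly"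
    have "S f \<noteq> {}" "S g \<noteq> {}" using neg by (auto simp: S_def variable_ideal_eq monomial_ideal_def)
    then obtain s t where st: "s \<in> S f" "t \<in> S g"
      and un: "\<And>a b. a \<in> S f \<Longrightarrow> b \<in> S g \<Longrightarrow> a + b = s + t \<Longrightarrow> a = s \<and> b = t"
      using ex_unique_sum[of "S f" "S g"] by (auto simp: S_def)
    have "Poly_Mapping.lookup (f * g) (s + t) = Poly_Mapping.lookup f s * Poly_Mapping.lookup g t"
    proof (rule lookup_mult_unique)
      fix a b assume ab: "a \<in> Poly_Mapping.keys f" "b \<in> Poly_Mapping.keys g" "a + b = s + t"
      then have "exp_mset a + exp_mset b = exp_mset s + exp_mset t" by (metis exp_mset_add)
      \<comment> \<open>Exponents are nonnegative, so \<open>a\<close> and \<open>b\<close> involve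
        only variables of \<open>s + t\<close>, none of which is in \<open>U\<close>.\<close>
      then have "set_mset (exp_mset a) \<union> set_mset (exp_mset b) = set_mset (exp_mset s) \<union> set_mset (exp_mset t)"
        by (metis set_mset_union)
      then have "a \<in> S f" "b \<in> S g" using ab st by (auto simp: S_def)
      then show "a = s \<and> b = t" using un ab(3) by blast
    qed (use st in \<open>auto simp: S_def\<close>)
    then have "s + t \<in> Poly_Mapping.keys (f * g)" using st by (simp add: S_def in_keys_iff)
    moreover have "Poly_Mapping.keys (f * g) \<subseteq> {t. \<exists>u\<in>U. u \<in># exp_mset t}"
      using fg by (simp add: variable_ideal_eq monomial_ideal_def)
    ultimately have "\<exists>u\<in>U. u \<in># exp_mset (s + t)" by blast
    then show False using st by (auto simp: S_def)
  qed
qed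

text \<open>Every element of the quotient is the class of a polynomial \<open>f\<close>, and its
  annihilator is the colon ideal of \<open>J\<close> by \<open>f\<close>.\<close>

lemma associated_prime_iff:
  fixes J P :: "('v, 'k::field) mpoly set"
  assumes J: "ideal J mpoly_ring"
  shows "associated_prime mpoly_ring J P \<longleftrightarrow> primeideal P mpoly_ring \<and> (\<exists>f. P = {r. r * f \<in> J})"
proof -
  interpret J: ideal J "mpoly_ring :: ('v, 'k) mpoly ring" by fact
  have carr: "carrier (mpoly_ring Quot J) = range (\<lambda>f. J +>\<^bsub>mpoly_ring\<^esub> f)"
    by (auto simp: FactRing_def A_RCOSETS_def')
  have "(J +>\<^bsub>mpoly_ring\<^esub> r) \<otimes>\<^bsub>mpoly_ring Quot J\<^esub> (J +>\<^bsub>mpoly_ring\<^esub> f) = \<zero>\<^bsub>mpoly_ring Quot J\<^esub>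
      \<longleftrightarrow> r * f \<in> J" for r f
  proof -
    have "(J +>\<^bsub>mpoly_ring\<^esub> r) \<otimes>\<^bsub>mpoly_ring Quot J\<^esub> (J +>\<^bsub>mpoly_ring\<^esub> f) = J +>\<^bsub>mpoly_ring\<^esub> (r * f)"
      using J.rcoset_mult_add[of r f] by (simp add: FactRing_def)
    moreover have "\<zero>\<^bsub>mpoly_ring Quot J\<^esub> = J" by (simp add: FactRing_def)
    moreover have "J +>\<^bsub>mpoly_ring\<^esub> (r * f) = J \<longleftrightarrow> r * f \<in> J"
      using J.a_rcos_zero[OF J, of "r * f"] J.rcos_const_imp_mem[of "r * f"] by auto
    ultimately show ?thesis by simp
  qed
  then show ?thesis unfolding associated_prime_def carr by simp
qed

section \<open>Embedded primes of powers of edge ideals\<close>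

lemma Var_in_variable_ideal_iff: "(Var u :: ('v, 'k::field) mpoly) \<in> variable_ideal U \<longleftrightarrow> u \<in> U"
  by (auto simp: variable_ideal_eq monomial_ideal_def Var_def)

lemma edge_power_in_ideal_power:
  assumes "{i, j} \<in> E"
  shows "(Var i * Var j :: ('v, 'k::field) mpoly) ^ k \<in> ideal_power mpoly_ring (edge_ideal E) k"
proof -
  have "Poly_Mapping.keys ((Var i * Var j :: ('v, 'k) mpoly) ^ k) \<subseteq> {t. matched E k (exp_mset t)}"
  proof (induction k)
    case (Suc k)
    have "exp_mset t = {#i, j#}" if "t \<in> Poly_Mapping.keys (Var i * Var j :: ('v, 'k) mpoly)" for t
      using that by (simp add: Var_def mult_single)
    then have "matched E (Suc k) (exp_mset (a + b))"
      if "a \<in> Poly_Mapping.keys (Var i * Var j :: ('v, 'k) mpoly)"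
        "b \<in> Poly_Mapping.keys ((Var i * Var j :: ('v, 'k) mpoly) ^ k)" for a b
      using that Suc matched_Suc[OF assms, of k "exp_mset b"] by auto
    then show ?case
      using keys_mult[of "Var i * Var j :: ('v, 'k) mpoly" "(Var i * Var j) ^ k"] by auto
  qed (simp add: matched_0)
  then show ?thesis unfolding ideal_power_edge_ideal by (simp add: monomial_ideal_def)
qed

text \<open>A prime containing a power of the edge ideal contains \<open>Var u * Var z\<close> for
  every edge \<open>{u, z}\<close>. If \<open>z\<close> lies in \<open>Z\<close>, then
  \<open>Var z\<close> is outside \<open>variable_ideal (neighbours E Z)\<close>, so a prime inside
  that ideal has to contain \<open>Var u\<close>.\<close>

lemma minimal_prime_neighbours:
  fixes E :: "'v::finite set set"
  assumes "neighbours E Z \<inter> Z = {}"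
    and sub: "ideal_power mpoly_ring (edge_ideal E) k \<subseteq> (variable_ideal (neighbours E Z) :: ('v, 'k::field) mpoly set)"
  shows "minimal_prime mpoly_ring (ideal_power mpoly_ring (edge_ideal E) k)
    (variable_ideal (neighbours E Z) :: ('v, 'k) mpoly set)"
  unfolding minimal_prime_def
proof (intro conjI primeideal_variable_ideal sub allI impI)
  let ?P = "variable_ideal (neighbours E Z) :: ('v, 'k) mpoly set"
  fix Q :: "('v, 'k) mpoly set"
  assume Q: "primeideal Q mpoly_ring \<and> ideal_power mpoly_ring (edge_ideal E) k \<subseteq> Q \<and> Q \<subseteq> ?P"
  interpret Q: primeideal Q "mpoly_ring :: ('v, 'k) mpoly ring" using Q by blast
  have prime: "f \<in> Q \<or> g \<in> Q" if "f * g \<in> Q" for f g using Q.I_prime[of f g] that by simp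
  have "1 \<notin> ?P" by (simp add: variable_ideal_eq monomial_ideal_def)
  then have one: "1 \<notin> Q" using Q by blast
  have "Var ` neighbours E Z \<subseteq> Q"
  proof
    fix x :: "('v, 'k) mpoly" assume "x \<in> Var ` neighbours E Z"
    then obtain u z where u: "x = Var u" "z \<in> Z" "{u, z} \<in> E"
      by (auto simp: neighbours_def insert_commute)
    let ?e = "Var u * Var z :: ('v, 'k) mpoly"
    have "?e ^ k \<in> Q" using edge_power_in_ideal_power[OF u(3), of k] Q by blast
    then have "?e \<in> Q"
      by (induction k) (use one prime in auto)
    then have "Var u \<in> Q \<or> Var z \<in> Q" by (rule prime)
    moreover have "Var z \<notin> ?P" using u(2) assms(1) by (auto simp: Var_in_variable_ideal_iff)
    ultimately show "x \<in> Q" using u(1) Q by blast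
  qed
  then have "?P \<subseteq> Q" unfolding variable_ideal_def
    by (intro Q.genideal_minimal Q.is_ideal)
  then show "Q = ?P" using Q by blast
qed

lemma monomial_mult_notin:
  fixes f :: "('v, 'k::field) mpoly"
  assumes "Poly_Mapping.single s 1 * f \<notin> monomial_ideal M"
  obtains w where "w \<in> Poly_Mapping.keys f" "s + w \<notin> M"
proof -
  have "Poly_Mapping.keys (Poly_Mapping.single s 1 * f) \<subseteq> (+) s ` Poly_Mapping.keys f"
    using keys_mult[of "Poly_Mapping.single s 1" f] by auto
  then show ?thesis using assms that by (auto simp: monomial_ideal_def)
qed

lemma keys_mult_single:
  fixes f :: "('v, 'k::field) mpoly"
  assumes "s \<in> Poly_Mapping.keys f"
  shows "s + w \<in> Poly_Mapping.keys (f * Poly_Mapping.single w 1)"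
  using keys_single_mult[OF one_neq_zero assms, of w] by (simp only: mult.commute add.commute)

lemma ideal_ideal_power:
  "ideal (ideal_power mpoly_ring (edge_ideal E) k :: ('v, 'k::field) mpoly set) mpoly_ring"
  unfolding ideal_power_edge_ideal by (rule ideal_monomial_ideal) (auto intro: matched_mono)

theorem theorem4p5:
  fixes V :: "'v::finite set" and E :: "'v set set" and U Z :: "'v set"
  assumes "V = UNIV"
    and "simple_graph V E"
    and "connected_graph V E"
    and "\<not> bipartite_graph V E"
    and "U \<subseteq> V"
    and "Z = V - U"
  shows "(\<exists>k\<ge>1. embedded_prime (mpoly_ring :: ('v, 'k::field) mpoly ring)
            (ideal_power mpoly_ring (edge_ideal E) k) (variable_ideal U))
    \<longleftrightarrow> coclique E Z \<and> U \<noteq> neighbours E Z \<and>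
        (\<forall>C \<in> graph_components (U - neighbours E Z) (induced_edges E (U - neighbours E Z)).
          contains_odd_cycle C (induced_edges E (U - neighbours E Z)))"
    (is "?L \<longleftrightarrow> ?R")
proof
  have card2: "card e = 2" if "e \<in> E" for e using assms(2) that by (auto simp: simple_graph_def)
  have U: "U = - Z" using assms(1,6) by auto
  let ?N = "neighbours E Z"
  let ?J = "\<lambda>k. ideal_power mpoly_ring (edge_ideal E) k :: ('v, 'k) mpoly set"
  let ?P = "variable_ideal U :: ('v, 'k) mpoly set"
  note assoc = associated_prime_iff[OF ideal_ideal_power]
  show ?R if ?L
  proof -
    from that obtain k where k: "embedded_prime (mpoly_ring :: ('v, 'k) mpoly ring) (?J k) ?P" by blast
    then obtain f where f: "?P = {r. r * f \<in> ?J k}" by (auto simp: embedded_prime_def assoc)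
    \<comment> \<open>Large enough for two uses: at least \<open>k\<close> for the coclique
      condition, and at least the degree of each monomial of \<open>f\<close> for pairing vertices
      with copies of \<open>Z\<close>.\<close>
    define n where "n = k + (\<Sum>t\<in>Poly_Mapping.keys f. size (exp_mset t))"
    obtain s where s: "exp_mset s = repeat_mset n (mset_set Z)" by (rule exp_mset_surj)
    have "Poly_Mapping.single s 1 \<notin> ?P"
    proof -
      have "u \<notin># exp_mset s" if "u \<in> U" for u using that U unfolding s by (auto simp flip: count_greater_zero_iff)
      then show ?thesis by (auto simp: variable_ideal_eq monomial_ideal_def)
    qed
    \<comment> \<open>The power of the variables in \<open>Z\<close> does not annihilate the class
      of \<open>f\<close>, so some monomial \<open>w\<close> of \<open>f\<close> stays outside the
      monomial ideal after multiplication.\<close>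
    then have "Poly_Mapping.single s 1 * f \<notin> ?J k" using f by blast
    then obtain w where w: "w \<in> Poly_Mapping.keys f" "s + w \<notin> {t. matched E k (exp_mset t)}"
      unfolding ideal_power_edge_ideal by (rule monomial_mult_notin)
    have nm: "\<not> matched E k (exp_mset w + repeat_mset n (mset_set Z))"
      using w(2) by (simp add: s add.commute)
    \<comment> \<open>No cancellation occurs when \<open>f\<close> is multiplied by a variable, so
      the multiple of \<open>w\<close> appears in \<open>Var u * f\<close> and lies in the
      ideal.\<close>
    have all: "matched E k (add_mset u (exp_mset w))" if "u \<in> - Z" for u
    proof -
      have "Var u * f \<in> ?J k" using f Var_in_variable_ideal_iff[of u U] that U by blast
      moreover have "Poly_Mapping.single u 1 + w \<in> Poly_Mapping.keys (Var u * f)"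
        unfolding Var_def by (rule keys_single_mult[OF one_neq_zero w(1)])
      ultimately have "matched E k (exp_mset (Poly_Mapping.single u 1 + w))"
        unfolding ideal_power_edge_ideal monomial_ideal_def by blast
      then show ?thesis by simp
    qed
    have "size (exp_mset w) \<le> (\<Sum>t\<in>Poly_Mapping.keys f. size (exp_mset t))"
      using w(1) by (intro member_le_sum) auto
    then have n: "size (exp_mset w) \<le> n" "k \<le> n" by (auto simp: n_def)
    have co: "coclique E Z"
      unfolding coclique_def
    proof (intro ballI notI)
      fix x y assume xy: "x \<in> Z" "y \<in> Z" "{x, y} \<in> E"
      then have "x \<noteq> y" using card2[of "{x, y}"] by auto
      with xy have "matched E n (repeat_mset n (mset_set Z))" by (intro matched_repeat) auto
      then have "matched E k (repeat_mset n (mset_set Z))" using n(2) by (rule matched_le)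
      then show False using nm matched_mono by (metis mset_subset_eq_add_right)
    qed
    moreover have "U \<noteq> ?N"
    proof
      assume UN: "U = ?N"
      \<comment> \<open>The prime annihilates a class modulo this power, hence contains the
        power.\<close>
      have "?J k \<subseteq> ?P"
      proof
        fix r assume "r \<in> ?J k"
        then have "r * f \<in> ?J k" using ideal.I_r_closed[OF ideal_ideal_power, of r E k f] by simp
        then show "r \<in> ?P" using f by blast
      qed
      then have "minimal_prime mpoly_ring (?J k) ?P"
        using minimal_prime_neighbours[of E Z k] U UN by auto
      then show False using k by (simp add: embedded_prime_def)
    qed
    moreover have "contains_odd_cycle C (induced_edges E (U - ?N))"
      if "C \<in> graph_components (U - ?N) (induced_edges E (U - ?N))" for C
      using components_contain_odd_cycle[OF card2 co n(1) nm all] that unfolding U by blast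
    ultimately show ?R by blast
  qed
  show ?L if R: ?R
  proof -
    from R have co: "coclique E Z" by blast
    obtain k w0 where w0: "\<And>b. set_mset b \<subseteq> Z \<Longrightarrow> \<not> matched E (Suc k) (w0 + b)"
      "\<And>u. u \<in> - Z \<Longrightarrow> matched E (Suc k) (add_mset u w0)"
      using ex_socle_multiset[OF card2 co] R unfolding U by blast
    obtain w where w: "exp_mset w = w0" by (rule exp_mset_surj)
    \<comment> \<open>Multiplying \<open>w\<close> by a variable from \<open>U\<close> produces
      \<open>Suc k\<close> edges, while multiplying it by variables from \<open>Z\<close> never
      does.\<close>
    have "?P = {r. r * Poly_Mapping.single w 1 \<in> ?J (Suc k)}"
    proof (intro Set.equalityI subsetI)
      fix r assume "r \<in> ?P"
      then have r: "\<exists>u\<in>U. u \<in># exp_mset s" if "s \<in> Poly_Mapping.keys r" for s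
        using that by (auto simp: variable_ideal_eq monomial_ideal_def)
      have "matched E (Suc k) (exp_mset (s + w))" if "s \<in> Poly_Mapping.keys r" for s
      proof -
        obtain u where u: "u \<in> U" "u \<in># exp_mset s" using r[OF \<open>s \<in> _\<close>] by blast
        have "{#u#} + w0 \<subseteq># exp_mset s + w0" using u(2) by (intro subset_mset.add_right_mono) simp
        then show ?thesis using matched_mono[OF w0(2)[of u]] u(1) U w by simp
      qed
      then have "Poly_Mapping.keys (r * Poly_Mapping.single w 1) \<subseteq> {t. matched E (Suc k) (exp_mset t)}"
        using keys_mult[of r "Poly_Mapping.single w 1"] by auto
      then show "r \<in> {r. r * Poly_Mapping.single w 1 \<in> ?J (Suc k)}"
        unfolding ideal_power_edge_ideal by (simp add: monomial_ideal_def)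
    next
      fix r :: "('v, 'k) mpoly" assume "r \<in> {r. r * Poly_Mapping.single w 1 \<in> ?J (Suc k)}"
      then have r: "Poly_Mapping.keys (r * Poly_Mapping.single w 1) \<subseteq> {t. matched E (Suc k) (exp_mset t)}"
        unfolding ideal_power_edge_ideal by (simp add: monomial_ideal_def)
      have "\<exists>u\<in>U. u \<in># exp_mset s" if "s \<in> Poly_Mapping.keys r" for s
      proof -
        have "matched E (Suc k) (exp_mset (s + w))" using r keys_mult_single[OF that] by blast
        then have "\<not> set_mset (exp_mset s) \<subseteq> Z" using w0(1)[of "exp_mset s"] w by (auto simp: add.commute)
        then show ?thesis using U by blast
      qed
      then show "r \<in> ?P" by (auto simp: variable_ideal_eq monomial_ideal_def)
    qed
    then have "associated_prime mpoly_ring (?J (Suc k)) ?P"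
      unfolding assoc using primeideal_variable_ideal by blast
    moreover have "\<not> minimal_prime mpoly_ring (?J (Suc k)) ?P"
    proof
      assume min: "minimal_prime mpoly_ring (?J (Suc k)) ?P"
      have "?N \<subseteq> U" using co U by (auto simp: coclique_def neighbours_def)
      then obtain u where u: "u \<in> U" "u \<notin> ?N" using R by blast
      let ?Q = "variable_ideal (U - {u}) :: ('v, 'k) mpoly set"
      \<comment> \<open>The set \<open>U - {u}\<close> is still a cover: as \<open>u\<close> is not
        in \<open>neighbours E Z\<close>, an edge at \<open>u\<close> has its other end in
        \<open>U\<close>, and any other edge meets \<open>U\<close> because \<open>Z\<close> is a
        coclique. So a strictly smaller prime contains the power.\<close>
      have meet: "e \<inter> (U - {u}) \<noteq> {}" if e: "e \<in> E" for e
      proof -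
        obtain x y where "e = {x, y}" "x \<noteq> y" using card2[OF e] by (auto simp: card_2_iff)
        then show ?thesis using e u co U by (auto simp: coclique_def neighbours_def insert_commute)
      qed
      have "?J (Suc k) \<subseteq> ?Q"
        unfolding ideal_power_edge_ideal variable_ideal_eq
      proof -
        have "\<exists>v\<in>U - {u}. v \<in># exp_mset t" if t: "matched E (Suc k) (exp_mset t)" for t
        proof -
          obtain x y b where "{x, y} \<in> E" "exp_mset t = {#x, y#} + b"
            using t[unfolded matched_Suc_iff] by metis
          then show ?thesis using meet[of "{x, y}"] by auto
        qed
        then show "monomial_ideal {t. matched E (Suc k) (exp_mset t)} \<subseteq>
          (monomial_ideal {t. \<exists>v\<in>U - {u}. v \<in># exp_mset t} :: ('v, 'k) mpoly set)"
          by (auto simp: monomial_ideal_def)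
      qed
      moreover have "?Q \<subseteq> ?P" by (auto simp: variable_ideal_eq monomial_ideal_def)
      ultimately have "?Q = ?P" using min primeideal_variable_ideal unfolding minimal_prime_def by blast
      then show False using u(1) Var_in_variable_ideal_iff[of u U] Var_in_variable_ideal_iff[of u "U - {u}"] by auto
    qed
    ultimately have "embedded_prime mpoly_ring (?J (Suc k)) ?P" by (simp add: embedded_prime_def)
    then show ?L by (metis le_add1 plus_1_eq_Suc)
  qed
qed

end
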